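(* Let $0<s<1$ be fixed and let $U$ be uniform on $[0,1]$. Let each edge $e$ of the complete digraph $\vec{K}_n$ on $n$ vertices be assigned a random weight $W_e$ and a random cost $C_e$, where $\{W_e,C_e\}_e$ is a family of i.i.d. random variables distributed as $U^s$. Suppose $c_0=c_0(n)$ satisfies $$n^{1-s}\log n\ll c_0\ll\frac{n}{\log n},$$ and let $W^*_{arb}$ be the optimum value of the problem: minimise $W(A)$ over spanning arborescences $A$ of $\vec{K}_n$ subject to $C(A)\le c_0$. Then with high probability as $n\to\infty$, $$W^*_{arb}\approx\frac{C_s^2\,n^{2-s}}{4c_0},\qquad\text{where } C_s=\Gamma(s/2+1)\left(\frac{\Gamma(2/s+1)}{\Gamma(1/s+1)^2}\right)^{s/2}.$$
   Context: $\vec{K}_n$ is the digraph on $[n]$ containing every ordered pair $(i,j)$ with $i\ne j$ as an edge. A spanning arborescence is a rooted spanning tree in which every edge is directed away from the root. For an arborescence $A$, $W(A)=\sum_{e\in A}W_e$ and $C(A)=\sum_{e\in A}C_e$. $a_n\ll b_n$ means $a_n/b_n\to0$ as $n\to\infty$. "With high probability" (w.h.p.) means with probability tending to $1$ as $n\to\infty$. "W.h.p. $A_n\approx B_n$" means there is a deterministic $\varepsilon(n)\to0$ such that $(1-\varepsilon)A_n\le B_n\le(1+\varepsilon)A_n$ with probability tending to $1$. $\Gamma$ is the Gamma function. *)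

theory Defs
  imports "HOL-Probability.Probability" "Graph_Theory.Digraph_Component"
begin

definition complete_dg :: "nat \<Rightarrow> nat pair_pre_digraph" where
  "complete_dg n =
     \<lparr>pverts = {1..n}, parcs = {(i, j). i \<in> {1..n} \<and> j \<in> {1..n} \<and> i \<noteq> j}\<rparr>"

(* T is an orientation of an undirected tree. The library's "tree" only forbids directed cycles,
   and it counts the back-and-forth walk u, v, u as a cycle, so it expresses neither trees in the
   underlying undirected graph of T nor trees as symmetric digraphs. A cycle of the underlying
   graph is a cycle of length at least 3 in the symmetric closure; loops and antiparallel arcs
   are excluded by asym. *)
definition oriented_tree :: "'a pair_pre_digraph \<Rightarrow> bool" where
  "oriented_tree T \<longleftrightarrow>
     asym (parcs T) \<and>
     Digraph_Component.connected (with_proj T) \<and>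
     \<not> (\<exists>p. pre_digraph.cycle (with_proj (mk_symmetric (with_proj T))) p \<and> 3 \<le> length p)"

(* An edge (u, v) points away from the root r iff the path from r to v in the underlying
   undirected tree ends by traversing it from u to v. *)
definition arborescence :: "'a pair_pre_digraph \<Rightarrow> 'a \<Rightarrow> bool" where
  "arborescence T r \<longleftrightarrow>
     oriented_tree T \<and> r \<in> pverts T \<and>
     (\<forall>(u, v) \<in> parcs T.
        \<exists>p. pre_digraph.apath (with_proj (mk_symmetric (with_proj T))) r (p @ [(u, v)]) v)"

definition spanning_arborescence :: "'a pair_pre_digraph \<Rightarrow> 'a pair_pre_digraph \<Rightarrow> bool" where
  "spanning_arborescence T G \<longleftrightarrow>
     spanning (with_proj T) (with_proj G) \<and> (\<exists>r. arborescence T r)"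

(* There are finitely many feasible arborescences, so the infimum is a minimum, and it is
   \<infinity> exactly if there is none. *)
definition opt_arb :: "nat \<Rightarrow> (nat \<times> nat \<Rightarrow> real) \<Rightarrow> (nat \<times> nat \<Rightarrow> real) \<Rightarrow> real \<Rightarrow> ereal" where
  "opt_arb n w c b =
     (INF T \<in> {T. spanning_arborescence T (complete_dg n) \<and> (\<Sum>e\<in>parcs T. c e) \<le> b}.
        ereal (\<Sum>e\<in>parcs T. w e))"

definition uniform_power :: "real \<Rightarrow> real measure" where
  "uniform_power s = distr (uniform_measure lborel {0..1}) borel (\<lambda>u. u powr s)"

definition arb_const :: "real \<Rightarrow> real" where
  "arb_const s = Gamma (s / 2 + 1) * (Gamma (2 / s + 1) / (Gamma (1 / s + 1))\<^sup>2) powr (s / 2)"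

(* Only meaningful if b is eventually nonzero, since x / 0 = 0. *)
definition much_less :: "(nat \<Rightarrow> real) \<Rightarrow> (nat \<Rightarrow> real) \<Rightarrow> bool" (infix \<open>\<lless>\<close> 50) where
  "a \<lless> b \<longleftrightarrow> (\<lambda>n. a n / b n) \<longlonglongrightarrow> 0"

definition whp_approx ::
  "(nat \<Rightarrow> 'a measure) \<Rightarrow> (nat \<Rightarrow> 'a \<Rightarrow> ereal) \<Rightarrow> (nat \<Rightarrow> 'a \<Rightarrow> ereal) \<Rightarrow> bool" where
  "whp_approx M A B \<longleftrightarrow>
     (\<exists>\<epsilon> :: nat \<Rightarrow> real. \<epsilon> \<longlonglongrightarrow> 0 \<and>
        (\<lambda>n. measure (M n) {\<omega> \<in> space (M n).
           ereal (1 - \<epsilon> n) * A n \<omega> \<le> B n \<omega> \<and> B n \<omega> \<le> ereal (1 + \<epsilon> n) * A n \<omega>}) \<longlonglongrightarrow> 1)"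

end

theory Submission
  imports Defs "HOL-Real_Asymp.Real_Asymp"
begin

text \<open>
  The proof is by Lagrangian relaxation. For a multiplier \<open>l > 0\<close> let \<open>m(v)\<close> be the minimum of
  \<open>W + l * C\<close> over the arcs into \<open>v\<close>, and \<open>\<phi>(l)\<close> the sum of all \<open>m(v)\<close>. Every vertex but the root
  of an arborescence has an incoming arc, so an arborescence of cost at most \<open>c0\<close> has weight at least
  \<open>\<phi>(l) - l * c0\<close>, up to the term of the root. Near 0 the distribution function of \<open>W + l * C\<close> is a
  multiple of \<open>t powr (2 / s)\<close>, and the \<open>m(v)\<close> are independent, whence \<open>\<phi>(l)\<close> is concentrated at
  \<open>arb_const s * n powr (1 - s / 2) * sqrt l\<close>. Maximising over \<open>l\<close> gives the lower bound.

  For the upper bound let every vertex choose the arc that attains \<open>m(v)\<close>. The total cost of the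
  chosen arcs is a supergradient of the concave function \<open>\<phi>\<close> at \<open>l\<close>, so it is determined by the values
  of \<open>\<phi>\<close> at nearby multipliers; a slightly larger \<open>l\<close> makes it smaller than \<open>c0\<close>. The chosen arcs form
  a random functional digraph, which has about \<open>ln n\<close> cycles on average. Replacing one
  arc of each cycle by an arc from the root yields an arborescence, and since single arcs have weight
  and cost at most 1, these replacements are negligible.
\<close>

section \<open>Arborescences\<close>

text \<open>Put \<open>mu = sqrt l * n powr (- s / 2)\<close> and
  \<open>D = simplex_const s\<close>. A minimum \<open>m(v)\<close> exceeds \<open>mu * x\<close>
  with probability about \<open>exp (- D * x powr (2 / s))\<close>; integrating this tail gives
  \<open>Gamma (s / 2 + 1) * D powr (- s / 2)\<close>, which is \<open>arb_const s\<close>. The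
  power law of \<open>W + l * C\<close> is exact, but only up to \<open>min 1 l\<close>. Hence the
  minima are truncated at \<open>mu * ln n\<close>: high enough that with high probability none
  exceeds it, since \<open>2 / s \<ge> 2\<close>, and low enough for Hoeffding's inequality. At the
  optimal multiplier \<open>mu\<close> has order \<open>n powr (1 - s) / c0\<close> and
  \<open>l\<close> has order \<open>n powr (2 - s) / c0\<^sup>2\<close>, so the lower growth bound
  on \<open>c0\<close> yields \<open>mu * ln n \<le> 1\<close> and the upper one yields
  \<open>mu * ln n \<le> l\<close>. The same two bounds make \<open>ln n\<close> negligible against
  the budget and against the optimum, which pays for the cycles. Concentration is required at three
  multipliers only, because secants of a concave function bound its supergradients.\<close>

lemma finite_parcs_complete_dg: "finite (parcs (complete_dg n))"
  by (rule finite_subset[of _ "{1..n} \<times> {1..n}"]) (auto simp: complete_dg_def)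

lemma mk_symmetric_with_proj:
  "parcs (mk_symmetric (with_proj T)) = parcs T \<union> (parcs T)\<inverse>"
  by (auto simp: parcs_mk_symmetric)

lemma set_rev_path: "set (rev_path p) = prod.swap ` set p"
  by (induction p) auto

text \<open>If the tree path from the root to \<open>v\<close> ended with an arc \<open>v \<rightarrow> x\<close> of the tree traversed backwards,
  it would close a cycle with the path from the root to \<open>x\<close> through \<open>v\<close>.\<close>

lemma arborescence_in_arc:
  assumes T: "arborescence T r" and wf: "pair_wf_digraph T" and v: "v \<in> pverts T" "v \<noteq> r"
  shows "\<exists>u. (u, v) \<in> parcs T"
proof (rule ccontr)
  assume no: "\<nexists>u. (u, v) \<in> parcs T"
  interpret T: pair_wf_digraph T by fact
  let ?S = "mk_symmetric (with_proj T)"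
  have S_wf: "pair_wf_digraph ?S" by (rule T.wellformed_mk_symmetric)
  have S_sym: "symmetric (with_proj ?S)" by (rule symmetric_mk_symmetric)
  interpret S: pair_sym_digraph ?S
    using S_wf S_sym by (simp add: pair_sym_digraph_def pair_sym_digraph_axioms_def)
  have as: "asym (parcs T)" and conn: "strongly_connected ?S"
    and nocyc: "\<not> (\<exists>p. S.cycle p \<and> 3 \<le> length p)"
    and r: "r \<in> pverts T"
    and path: "\<And>u v. (u, v) \<in> parcs T \<Longrightarrow> \<exists>p. S.apath r (p @ [(u, v)]) v"
    using T by (auto simp: arborescence_def oriented_tree_def Digraph_Component.connected_def)
  have "r \<rightarrow>\<^sup>*\<^bsub>?S\<^esub> v"
    using conn r v by (auto simp: strongly_connected_def)
  then obtain p where p: "S.apath r p v"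
    by (auto simp: S.reachable_apath)
  have "p \<noteq> []"
    using p v by (auto simp: S.apath_Nil_iff)
  then obtain q x v' where "p = q @ [(x, v')]"
    by (metis rev_exhaust surj_pair)
  with p have pq: "S.apath r (q @ [(x, v)]) v"
    by (auto simp: S.apath_append_iff S.apath_simps)
  hence xv: "(x, v) \<in> parcs ?S" and q: "S.apath r q x" and qv: "v \<notin> set (S.awalk_verts r q)"
    by (auto simp: S.apath_append_iff S.apath_simps)
  have vx: "(v, x) \<in> parcs T"
    using xv no by (auto simp: mk_symmetric_with_proj)
  have neq: "x \<noteq> v"
    using vx as by (auto simp: asym_on_def)
  obtain p' where "S.apath r (p' @ [(v, x)]) x"
    using path[OF vx] by blast
  hence p': "S.apath r p' v" and p'x: "x \<notin> set (S.awalk_verts r p')"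
    by (auto simp: S.apath_append_iff S.apath_simps)
  have w: "S.awalk x (rev_path q @ p') v"
    using q p' S.awalk_appendI[of x "rev_path q" r p' v] unfolding S.apath_def by simp
  have sub: "(x, v) \<notin> set (rev_path q @ p')"
  proof
    assume "(x, v) \<in> set (rev_path q @ p')"
    then consider "(x, v) \<in> set p'" | "(v, x) \<in> set q"
      by (force simp: set_rev_path)
    thus False
    proof cases
      case 1
      thus ?thesis using p'x S.awalk_verts_arc1[of "(x,v)" p' r] by simp
    next
      case 2
      thus ?thesis using qv S.awalk_verts_arc1[of "(v,x)" q r] by simp
    qed
  qed
  define c where "c = S.awalk_to_apath (rev_path q @ p')"
  have c: "S.apath x c v" and c': "(x, v) \<notin> set c"
    using S.apath_awalk_to_apath[OF w] S.awalk_to_apath_subset[OF w] sub by (auto simp: c_def)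
  have "2 \<le> length c"
  proof (rule ccontr)
    assume "\<not> 2 \<le> length c"
    then consider "c = []" | e where "c = [e]"
      by (cases c) (auto simp: Suc_le_eq)
    thus False
      using c c' neq by cases (auto simp: S.apath_simps)
  qed
  moreover have "S.cycle (c @ [(v, x)])"
  proof -
    have "(v, x) \<in> parcs ?S"
      using vx by (auto simp: mk_symmetric_with_proj)
    hence a: "S.awalk x (c @ [(v, x)]) x"
      using c S.wellformed'(2)[of v x] 
      by (intro S.awalk_appendI[of x c v]) (auto simp: S.apath_def S.awalk_simps)
    have l: "last (S.awalk_verts x c) = v"
      using c unfolding S.apath_def by auto
    have "S.awalk_verts x c \<noteq> []" by (rule S.awalk_verts_non_Nil)
    moreover have "hd (S.awalk_verts x c) = x"
      using c unfolding S.apath_def by auto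
    ultimately have e: "S.awalk_verts x c = x # tl (S.awalk_verts x c)"
      by (metis list.collapse)
    have d: "distinct (x # tl (S.awalk_verts x c))"
      using c e unfolding S.apath_def by metis
    have "S.awalk_verts x (c @ [(v, x)]) = x # tl (S.awalk_verts x c) @ [x]"
      using S.awalk_verts_append[OF a] l e by simp
    thus ?thesis
      using a d unfolding S.cycle_def by (intro exI[of _ x]) auto
  qed
  ultimately show False
    using nocyc by (auto dest!: spec[of _ "c @ [(v, x)]"])
qed

section \<open>Trees given by parent maps\<close>

definition parent_tree :: "'a set \<Rightarrow> 'a \<Rightarrow> ('a \<Rightarrow> 'a) \<Rightarrow> 'a pair_pre_digraph" where
  "parent_tree V r f = \<lparr> pverts = V, parcs = (\<lambda>v. (f v, v)) ` (V - {r}) \<rparr>"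

lemma sum_parent_tree:
  "(\<Sum>e\<in>parcs (parent_tree V r f). w e) = (\<Sum>v\<in>V - {r}. w (f v, v))"
  by (simp add: parent_tree_def sum.reindex inj_on_def)

lemma pcas_nthD:
  assumes "pcas u p v"
  shows "p \<noteq> [] \<Longrightarrow> fst (hd p) = u" "p \<noteq> [] \<Longrightarrow> snd (last p) = v"
    "Suc i < length p \<Longrightarrow> snd (p ! i) = fst (p ! Suc i)"
  using assms
proof (induction p arbitrary: u i)
  case (Cons e p)
  { case 1 thus ?case using Cons by simp }
  { case 2 thus ?case using Cons by (cases p) auto }
  { case (3 i) thus ?case using Cons by (cases p; cases i) auto }
qed auto

text \<open>Everything is read off the depth \<open>d\<close>, the number of steps to
  \<open>r\<close>, which grows by one along every arc. This excludes antiparallel arcs. On a cycle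
  of the underlying graph a vertex of maximal depth would have its parent as both neighbours, but
  the vertices of a cycle are distinct.\<close>

lemma arborescence_parent_tree:
  assumes r: "r \<in> V" and f: "\<And>v. v \<in> V \<Longrightarrow> f v \<in> V"
    and reach: "\<And>v. v \<in> V \<Longrightarrow> \<exists>k. (f ^^ k) v = r"
  shows "arborescence (parent_tree V r f) r"
proof -
  let ?T = "parent_tree V r f"
  let ?S = "mk_symmetric (with_proj ?T)"
  define d where "d v = (LEAST k. (f ^^ k) v = r)" for v
  have d_Suc: "d v = Suc (d (f v))" if v: "v \<in> V" "v \<noteq> r" for v
  proof -
    obtain k where "(f ^^ k) v = r" using reach[OF v(1)] by blast
    hence "d v = Suc (LEAST m. (f ^^ Suc m) v = r)"
      unfolding d_def using v(2) by (intro Least_Suc) auto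
    thus ?thesis by (simp add: d_def funpow_Suc_right del: funpow.simps(2))
  qed
  have T_arc: "(a, b) \<in> parcs ?T \<longleftrightarrow> b \<in> V \<and> b \<noteq> r \<and> a = f b" for a b
    by (auto simp: parent_tree_def)
  have [simp]: "pverts ?T = V" by (simp add: parent_tree_def)
  interpret T: pair_wf_digraph ?T
    by unfold_locales (auto simp: T_arc f)
  have S_wf: "pair_wf_digraph ?S" by (rule T.wellformed_mk_symmetric)
  have S_sym: "symmetric (with_proj ?S)" by (rule symmetric_mk_symmetric)
  interpret S: pair_sym_digraph ?S
    using S_wf S_sym by (simp add: pair_sym_digraph_def pair_sym_digraph_axioms_def)
  have up: "a = f b" if "(a, b) \<in> parcs ?S" "d a \<le> d b" for a b
    using that d_Suc[of a] by (auto simp: mk_symmetric_with_proj T_arc)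
  \<comment> \<open>The depth bound is carried along to keep \<open>v\<close> off the path to its
    parent; the last clause records the final arc, which is what \<open>arborescence\<close> asks
    for.\<close>
  have path: "\<exists>p. S.apath r p v \<and> (\<forall>x\<in>set (S.awalk_verts r p). d x \<le> d v) \<and> (v \<noteq> r \<longrightarrow> (\<exists>q. p = q @ [(f v, v)]))"
    if "v \<in> V" for v
    using that
  proof (induction "d v" arbitrary: v)
    case 0
    hence "v = r" using d_Suc by fastforce
    thus ?case using r by (intro exI[of _ "[]"]) (auto simp: S.apath_simps)
  next
    case (Suc k)
    show ?case
    proof (cases "v = r")
      case True
      thus ?thesis using r by (intro exI[of _ "[]"]) (auto simp: S.apath_simps)
    next
      case False
      have dv: "d v = Suc (d (f v))" using d_Suc False Suc by auto
      obtain p where p: "S.apath r p (f v)" "\<forall>x\<in>set (S.awalk_verts r p). d x \<le> d (f v)"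
        using Suc.hyps dv f[OF Suc.prems] by (metis Suc_inject)
      have "(f v, v) \<in> parcs ?S" using False Suc by (auto simp: mk_symmetric_with_proj T_arc)
      moreover have "v \<notin> set (S.awalk_verts r p)" using p(2) dv by force
      moreover have "last (S.awalk_verts r p) = f v"
        using p(1) unfolding S.apath_def by auto
      ultimately have ap: "S.apath r (p @ [(f v, v)]) v"
        using p(1) dv Suc(3) by (auto simp: S.apath_append_iff S.apath_simps)
      moreover have "S.awalk_verts r (p @ [(f v, v)]) = S.awalk_verts r p @ [v]"
        using S.awalk_verts_append[of r p "[(f v, v)]" v] ap unfolding S.apath_def by simp
      ultimately show ?thesis
        using p(2) dv by (intro exI[of _ "p @ [(f v, v)]"]) auto
    qed
  qed
  have "asym (parcs ?T)"
  proof (rule asymI)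
    fix a b assume *: "(a, b) \<in> parcs ?T"
    show "(b, a) \<notin> parcs ?T"
    proof
      assume "(b, a) \<in> parcs ?T"
      with * show False using d_Suc[of a] d_Suc[of b] by (auto simp: T_arc)
    qed
  qed
  moreover have "Digraph_Component.connected (with_proj ?T)"
    unfolding Digraph_Component.connected_def
  proof (rule strongly_connectedI)
    show "verts ?S \<noteq> {}" using r by auto
    fix u v assume "u \<in> verts ?S" "v \<in> verts ?S"
    then obtain p q where "S.apath r p u" "S.apath r q v"
      using path by fastforce
    hence "S.awalk u (rev_path p @ q) v"
      unfolding S.apath_def by (intro S.awalk_appendI[of u _ r]) auto
    thus "u \<rightarrow>\<^sup>*\<^bsub>?S\<^esub> v" by (rule S.reachable_awalkI)
  qed
  moreover have "\<not> (\<exists>p. S.cycle p \<and> 3 \<le> length p)"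
  proof
    assume "\<exists>p. S.cycle p \<and> 3 \<le> length p"
    then obtain p u where p: "S.awalk u p u" "distinct (tl (S.awalk_verts u p))" "3 \<le> length p"
      by (auto simp: S.cycle_def)
    define n where "n = length p"
    define h where "h i = snd (p ! i)" for i
    have cas: "pcas u p u" and sub: "set p \<subseteq> parcs ?S"
      using p(1) by (auto simp: S.awalk_def)
    have pne: "p \<noteq> []" using p by auto
    have h0: "fst (p ! 0) = h (n - 1)"
      using pcas_nthD(1,2)[OF cas pne] pne by (simp add: h_def n_def hd_conv_nth last_conv_nth)
    have hS: "fst (p ! Suc i) = h i" if "Suc i < n" for i
      using pcas_nthD(3)[OF cas] that by (simp add: h_def n_def)
    have "tl (S.awalk_verts u p) = map snd p"
      using S.awalk_verts_conv'[of u p u] cas pne by simp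
    hence inj: "inj_on h {..<n}"
      using p(2) by (auto simp: distinct_map inj_on_def h_def n_def distinct_conv_nth)
    define D where "D = (\<lambda>i. d (h i)) ` {..<n}"
    have D: "finite D" "Max D \<in> D"
      unfolding D_def using pne by (auto simp: n_def intro!: Max_in)
    then obtain i where i: "i < n" "d (h i) = Max D" by (auto simp: D_def)
    have max: "d (h j) \<le> d (h i)" if "j < n" for j
      unfolding i(2) using D(1) that by (intro Max_ge) (auto simp: D_def)
    \<comment> \<open>The positions before and after \<open>i\<close>, read cyclically. They differ
      because the cycle has at least three arcs.\<close>
    define a where "a = (if i = 0 then n - 1 else i - 1)"
    define b where "b = (if Suc i = n then 0 else Suc i)"
    have ab: "a < n" "b < n" "a \<noteq> b" using i(1) p(3) by (auto simp: a_def b_def n_def split: if_splits)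
    have "p ! i = (h a, h i)" "p ! b = (h i, h b)"
      using h0 hS[of "i - 1"] hS[of i] i(1) by (auto simp: a_def b_def prod_eq_iff h_def)
    hence arcs: "(h a, h i) \<in> parcs ?S" "(h i, h b) \<in> parcs ?S"
      using sub ab i(1) by (metis n_def nth_mem subsetD)+
    hence "(h b, h i) \<in> parcs ?S" by (auto simp: mk_symmetric_with_proj)
    hence "h a = h b" using up[of "h a" "h i"] up[of "h b" "h i"] arcs max ab by auto
    thus False using inj ab by (auto simp: inj_on_def)
  qed
  moreover have "\<exists>p. S.apath r (p @ [(u, v)]) v" if "(u, v) \<in> parcs ?T" for u v
    using that path[of v] by (auto simp: T_arc)
  ultimately show ?thesis
    using r unfolding arborescence_def oriented_tree_def by auto
qed

lemma spanning_arborescence_parent_tree: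
  assumes r: "r \<in> {1..n}" and f: "\<And>v. v \<in> {1..n} \<Longrightarrow> f v \<in> {1..n}"
    and ne: "\<And>v. v \<in> {1..n} \<Longrightarrow> v \<noteq> r \<Longrightarrow> f v \<noteq> v"
    and reach: "\<And>v. v \<in> {1..n} \<Longrightarrow> \<exists>k. (f ^^ k) v = r"
  shows "spanning_arborescence (parent_tree {1..n} r f) (complete_dg n)"
proof -
  have wf: "pair_wf_digraph (complete_dg n)"
    by unfold_locales (auto simp: complete_dg_def)
  have wf': "pair_wf_digraph (parent_tree {1..n} r f)"
    using f by unfold_locales (auto simp: parent_tree_def)
  have "arborescence (parent_tree {1..n} r f) r"
    by (rule arborescence_parent_tree[OF r f reach])
  moreover have "spanning (with_proj (parent_tree {1..n} r f)) (with_proj (complete_dg n))"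
  proof -
    have "parcs (parent_tree {1..n} r f) \<subseteq> parcs (complete_dg n)"
      using f ne unfolding parent_tree_def complete_dg_def by fastforce
    moreover have "pverts (parent_tree {1..n} r f) = pverts (complete_dg n)"
      by (simp add: parent_tree_def complete_dg_def)
    ultimately show ?thesis
      using wf wf' by (simp add: spanning_def subgraph_def wf_digraph_wp_iff compatible_def)
  qed
  ultimately show ?thesis unfolding spanning_arborescence_def by blast
qed

lemma parcs_spanning_arborescence:
  "spanning_arborescence T (complete_dg n) \<Longrightarrow> parcs T \<subseteq> parcs (complete_dg n)"
  by (simp add: spanning_arborescence_def spanning_def subgraph_def)

lemma spanning_arborescence_parent:
  assumes "spanning_arborescence T (complete_dg n)"
  shows "\<exists>r\<in>{1..n}. \<exists>g. \<forall>v\<in>{1..n} - {r}. (g v, v) \<in> parcs T"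
proof -
  obtain r where r: "arborescence T r" and sp: "spanning (with_proj T) (with_proj (complete_dg n))"
    using assms by (auto simp: spanning_arborescence_def)
  have "pverts (complete_dg n) = pverts T" and wf: "pair_wf_digraph T"
    using sp by (simp_all add: spanning_def subgraph_def wf_digraph_wp_iff)
  hence V: "pverts T = {1..n}" by (simp add: complete_dg_def)
  have "\<exists>u. (u, v) \<in> parcs T" if "v \<in> {1..n} - {r}" for v
    using arborescence_in_arc[OF r wf, of v] that V by auto
  then obtain g where "\<forall>v\<in>{1..n} - {r}. (g v, v) \<in> parcs T" by metis
  moreover have "r \<in> {1..n}" using r V by (auto simp: arborescence_def)
  ultimately show ?thesis by blast
qed

section \<open>Minimal incoming arcs\<close>

definition min_in :: "nat \<Rightarrow> (nat \<times> nat \<Rightarrow> real) \<Rightarrow> nat \<Rightarrow> real" where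
  "min_in n x v = Min ((\<lambda>u. x (u, v)) ` ({1..n} - {v}))"

definition min_sum :: "nat \<Rightarrow> (nat \<times> nat \<Rightarrow> real) \<Rightarrow> real" where
  "min_sum n x = (\<Sum>v\<in>{1..n}. min_in n x v)"

definition minimal_arc :: "nat \<Rightarrow> (nat \<times> nat \<Rightarrow> real) \<Rightarrow> nat \<Rightarrow> nat \<Rightarrow> bool" where
  "minimal_arc n x u v \<longleftrightarrow> u \<in> {1..n} - {v} \<and> (\<forall>w\<in>{1..n} - {v}. x (u, v) \<le> x (w, v))"

text \<open>The arcs of the closed walk that visits \<open>v\<close> and then \<open>ys\<close>, against the direction of the arcs.\<close>

definition minimal_cycle :: "nat \<Rightarrow> (nat \<times> nat \<Rightarrow> real) \<Rightarrow> nat \<Rightarrow> nat list \<Rightarrow> bool" where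
  "minimal_cycle n x v ys \<longleftrightarrow>
     (\<forall>i<Suc (length ys). minimal_arc n x ((ys @ [v]) ! i) ((v # ys) ! i))"

text \<open>A cycle is registered at its largest vertex, so cutting the arcs into these vertices
  breaks every cycle. No choice among tied minimal arcs enters: the set covers the cycles of all
  choices. For \<open>ys = []\<close> the cycle would be a loop, which \<open>minimal_arc\<close>
  excludes.\<close>

definition cycle_maxima :: "nat \<Rightarrow> (nat \<times> nat \<Rightarrow> real) \<Rightarrow> nat set" where
  "cycle_maxima n x =
     {v \<in> {1..n}. \<exists>ys. distinct ys \<and> set ys \<subseteq> {1..<v} \<and> minimal_cycle n x v ys}"

lemma in_nbrs_nonempty: "2 \<le> n \<Longrightarrow> {1..n} - {v::nat} \<noteq> {}"
proof -
  assume "2 \<le> n"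
  hence "(if v = 1 then 2 else 1) \<in> {1..n} - {v}" by auto
  thus ?thesis by blast
qed

lemma min_in_le: "(u, v) \<in> parcs (complete_dg n) \<Longrightarrow> min_in n x v \<le> x (u, v)"
  unfolding min_in_def by (intro Min_le) (auto simp: complete_dg_def)

lemma ex_minimal_arc: "2 \<le> n \<Longrightarrow> \<exists>u. minimal_arc n x u v \<and> x (u, v) = min_in n x v"
proof -
  assume n: "2 \<le> n"
  have "min_in n x v \<in> (\<lambda>u. x (u, v)) ` ({1..n} - {v})"
    unfolding min_in_def using in_nbrs_nonempty[OF n] by (intro Min_in) auto
  then obtain u where u: "u \<in> {1..n} - {v}" "x (u, v) = min_in n x v" by (metis (no_types, lifting) imageE)
  moreover have "x (u, v) \<le> x (w, v)" if "w \<in> {1..n} - {v}" for w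
    using that u unfolding min_in_def by (simp add: Min_le)
  ultimately show ?thesis unfolding minimal_arc_def by blast
qed

lemma weight_lower_bound:
  assumes n: "2 \<le> n" and T: "spanning_arborescence T (complete_dg n)"
    and w: "\<And>e. e \<in> parcs (complete_dg n) \<Longrightarrow> w e \<in> {0..1}"
    and c: "\<And>e. e \<in> parcs (complete_dg n) \<Longrightarrow> c e \<in> {0..1}"
    and l: "0 \<le> l" and b: "(\<Sum>e\<in>parcs T. c e) \<le> b"
  shows "min_sum n (\<lambda>e. w e + l * c e) - (1 + l) - l * b \<le> (\<Sum>e\<in>parcs T. w e)"
proof -
  let ?x = "\<lambda>e. w e + l * c e"
  obtain r g where r: "r \<in> {1..n}" and g: "\<And>v. v \<in> {1..n} - {r} \<Longrightarrow> (g v, v) \<in> parcs T"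
    using spanning_arborescence_parent[OF T] by blast
  have sub: "parcs T \<subseteq> parcs (complete_dg n)"
    by (rule parcs_spanning_arborescence[OF T])
  have fin: "finite (parcs T)"
    using sub finite_parcs_complete_dg by (rule finite_subset)
  \<comment> \<open>The parent map gives no arc into the root; an arbitrary arc of the complete
    digraph into it bounds its minimum by \<open>1 + l\<close>.\<close>
  obtain u where u: "u \<in> {1..n} - {r}"
    using in_nbrs_nonempty[OF n] by blast
  hence "(u, r) \<in> parcs (complete_dg n)" using r by (auto simp: complete_dg_def)
  hence "min_in n ?x r \<le> 1 + l"
    using min_in_le[of u r n ?x] w[of "(u, r)"] c[of "(u, r)"] l mult_left_mono[of "c (u, r)" 1 l] by auto
  moreover have "(\<Sum>v\<in>{1..n} - {r}. min_in n ?x v) \<le> (\<Sum>v\<in>{1..n} - {r}. ?x (g v, v))"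
    using g sub by (intro sum_mono min_in_le) auto
  moreover have "(\<Sum>v\<in>{1..n} - {r}. ?x (g v, v)) = sum ?x ((\<lambda>v. (g v, v)) ` ({1..n} - {r}))"
    by (subst sum.reindex) (auto simp: inj_on_def)
  moreover have "\<dots> \<le> sum ?x (parcs T)"
  proof (rule sum_mono2[OF fin])
    show "(\<lambda>v. (g v, v)) ` ({1..n} - {r}) \<subseteq> parcs T"
      by (rule image_subsetI) (rule g)
    fix e assume "e \<in> parcs T - (\<lambda>v. (g v, v)) ` ({1..n} - {r})"
    hence "e \<in> parcs (complete_dg n)" using sub by blast
    thus "0 \<le> ?x e" using w[of e] c[of e] l by simp
  qed
  moreover have "sum ?x (parcs T) = (\<Sum>e\<in>parcs T. w e) + l * (\<Sum>e\<in>parcs T. c e)"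
    by (simp add: sum.distrib sum_distrib_left)
  moreover have "l * (\<Sum>e\<in>parcs T. c e) \<le> l * b"
    using b l by (intro mult_left_mono) auto
  moreover have "min_sum n ?x = min_in n ?x r + (\<Sum>v\<in>{1..n} - {r}. min_in n ?x v)"
    unfolding min_sum_def using r by (subst sum.remove[of _ r]) auto
  ultimately show ?thesis by linarith
qed

text \<open>An orbit that misses \<open>r\<close> never meets \<open>Z\<close>, so along it the
  redirected map agrees with \<open>p\<close>. By finiteness it runs into a cycle of
  \<open>p\<close>, whose largest vertex belongs to \<open>Z\<close>, a contradiction.\<close>

lemma reaches_root:
  assumes V: "finite V" and p: "\<And>v::nat. v \<in> V \<Longrightarrow> p v \<in> V" and v: "v \<in> V"
    and Z: "\<And>y ys. y \<in> V \<Longrightarrow> distinct ys \<Longrightarrow> set ys \<subseteq> {z \<in> V. z < y} \<Longrightarrow>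
       (\<And>i. i < Suc (length ys) \<Longrightarrow> p ((y # ys) ! i) = (ys @ [y]) ! i) \<Longrightarrow> y \<in> Z"
    and r: "r \<in> V"
  shows "\<exists>k. ((\<lambda>v. if v \<in> Z then r else p v) ^^ k) v = r"
proof (rule ccontr)
  define f where "f = (\<lambda>v. if v \<in> Z then r else p v)"
  assume "\<not> ?thesis"
  hence nr: "(f ^^ k) v \<noteq> r" for k by (auto simp: f_def)
  define O' where "O' = range (\<lambda>k. (f ^^ k) v)"
  have fV: "f u \<in> V" if "u \<in> V" for u using that p r by (auto simp: f_def)
  have OV: "O' \<subseteq> V"
  proof
    fix x assume "x \<in> O'"
    then obtain k where "x = (f ^^ k) v" by (auto simp: O'_def)
    thus "x \<in> V" using v fV by (induction k arbitrary: x) auto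
  qed
  have step: "f u \<in> O'" if u: "u \<in> O'" for u
  proof -
    obtain k where "u = (f ^^ k) v" using u by (auto simp: O'_def)
    hence "f u = (f ^^ Suc k) v" by simp
    thus ?thesis unfolding O'_def by blast
  qed
  have Z_disj: "u \<notin> Z" if "u \<in> O'" for u
    using step[OF that] nr by (auto simp: f_def O'_def split: if_splits) metis
  have fp: "f u = p u" if "u \<in> O'" for u using Z_disj[OF that] by (simp add: f_def)
  have "\<not> inj (\<lambda>k. (f ^^ k) v)"
    using finite_subset[OF OV V] finite_imageD[of "\<lambda>k. (f ^^ k) v" UNIV] by (auto simp: O'_def)
  then obtain i j where "i < j" "(f ^^ i) v = (f ^^ j) v"
    by (metis (no_types, lifting) injI linorder_neqE_nat)
  define u where "u = (f ^^ i) v"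
  define per where "per = j - i"
  have per: "per > 0" "(f ^^ per) u = u"
  proof -
    have "(f ^^ per) u = (f ^^ (per + i)) v" by (simp add: funpow_add u_def)
    thus "per > 0" "(f ^^ per) u = u"
      using \<open>i < j\<close> \<open>(f ^^ i) v = (f ^^ j) v\<close> by (simp_all add: per_def u_def)
  qed
  \<comment> \<open>The periodic part of the orbit, on which \<open>y\<close> will be the largest
    element.\<close>
  define C where "C = range (\<lambda>k. (f ^^ k) u)"
  have CO: "C \<subseteq> O'"
    unfolding C_def O'_def u_def by (auto simp flip: comp_apply[of "f ^^ _" "f ^^ i"] funpow_add)
  have finC: "finite C" using CO OV V by (meson finite_subset)
  define y where "y = Max C"
  have yC: "y \<in> C" unfolding y_def using finC by (intro Max_in) (auto simp: C_def)
  have ymax: "z \<le> y" if "z \<in> C" for z unfolding y_def using finC that by auto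
  have yper: "(f ^^ per) y = y"
  proof -
    obtain k where k: "y = (f ^^ k) u" using yC by (auto simp: C_def)
    hence "(f ^^ per) y = (f ^^ k) ((f ^^ per) u)"
      by (simp flip: comp_apply[of "f ^^ _" "f ^^ _"] funpow_add add: add.commute)
    thus ?thesis using per k by simp
  qed
  have orbC: "(f ^^ k) y \<in> C" for k
  proof -
    obtain m where "y = (f ^^ m) u" using yC by (auto simp: C_def)
    hence "(f ^^ k) y = (f ^^ (k + m)) u" by (simp add: funpow_add)
    thus ?thesis unfolding C_def by blast
  qed
  \<comment> \<open>The least period of \<open>y\<close>, so that the iterates listed in
    \<open>ys\<close> are distinct and differ from \<open>y\<close>.\<close>
  define q where "q = (LEAST q. 0 < q \<and> (f ^^ q) y = y)"
  have q: "0 < q" "(f ^^ q) y = y"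
    using LeastI[of "\<lambda>q. 0 < q \<and> (f ^^ q) y = y" per] per yper by (auto simp: q_def)
  have qmin: "(f ^^ k) y \<noteq> y" if "0 < k" "k < q" for k
    using not_less_Least[of k "\<lambda>q. 0 < q \<and> (f ^^ q) y = y"] that by (auto simp: q_def)
  define ys where "ys = map (\<lambda>k. (f ^^ k) y) [1..<q]"
  have ys: "(y # ys) ! k = (f ^^ k) y" if "k < q" for k
    using that by (cases k) (auto simp: ys_def)
  \<comment> \<open>\<open>ys @ [y]\<close> is \<open>y # ys\<close> shifted by one application of
    \<open>f\<close>; in the last position the period wraps around to \<open>y\<close>.\<close>
  have ys': "(ys @ [y]) ! k = (f ^^ Suc k) y" if "k < q" for k
  proof (cases "Suc k < q")
    case True
    thus ?thesis by (auto simp: ys_def nth_append)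
  next
    case False
    hence "Suc k = q" "length ys = k" using that by (auto simp: ys_def)
    thus ?thesis using q(2) by (metis nth_append_length)
  qed
  have "inj_on (\<lambda>k. (f ^^ k) y) {1..<q}"
  proof (rule linorder_inj_onI)
    fix a b assume ab: "a < b" "a \<in> {1..<q}" "b \<in> {1..<q}"
    show "(f ^^ a) y \<noteq> (f ^^ b) y"
    proof
      assume "(f ^^ a) y = (f ^^ b) y"
      hence "(f ^^ (q - b)) ((f ^^ a) y) = (f ^^ (q - b)) ((f ^^ b) y)" by simp
      hence "(f ^^ (q - b + a)) y = (f ^^ q) y"
        using ab by (simp flip: comp_apply[of "f ^^ _" "f ^^ _"] funpow_add)
      moreover have "0 < q - b + a" "q - b + a < q" using ab by auto
      ultimately show False using q(2) qmin by metis
    qed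
  qed auto
  hence "distinct ys" by (auto simp: ys_def distinct_map)
  moreover have "set ys \<subseteq> {z \<in> V. z < y}"
  proof
    fix z assume "z \<in> set ys"
    then obtain k where "z = (f ^^ k) y" "0 < k" "k < q" by (auto simp: ys_def)
    thus "z \<in> {z \<in> V. z < y}" using orbC[of k] ymax[of z] qmin[of k] CO OV by force
  qed
  moreover have "p ((y # ys) ! k) = (ys @ [y]) ! k" if "k < Suc (length ys)" for k
  proof -
    have "k < q" using that q by (simp add: ys_def)
    thus ?thesis using ys[of k] ys'[of k] fp[of "(f ^^ k) y"] orbC[of k] CO by auto
  qed
  ultimately have "y \<in> Z" using Z[of y ys] yC CO OV by blast
  thus False using Z_disj yC CO by blast
qed

text \<open>The cost bounds come from \<open>min_sum\<close> being concave in the multiplier, with the total cost of the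
  minimal arcs as a supergradient.\<close>

lemma ex_cheap_arborescence:
  assumes n: "2 \<le> n"
    and w: "\<And>e. e \<in> parcs (complete_dg n) \<Longrightarrow> w e \<in> {0..1}"
    and c: "\<And>e. e \<in> parcs (complete_dg n) \<Longrightarrow> c e \<in> {0..1}"
    and l: "0 < l" "l1 < l" "l < l2"
  defines "\<phi> \<equiv> \<lambda>l. min_sum n (\<lambda>e. w e + l * c e)"
  defines "z \<equiv> real (card (cycle_maxima n (\<lambda>e. w e + l * c e)))"
  shows "\<exists>T. spanning_arborescence T (complete_dg n) \<and>
    (\<Sum>e\<in>parcs T. c e) \<le> (\<phi> l - \<phi> l1) / (l - l1) + z \<and>
    (\<Sum>e\<in>parcs T. w e) \<le> \<phi> l - l * ((\<phi> l2 - \<phi> l) / (l2 - l)) + z"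
proof -
  let ?x = "\<lambda>e. w e + l * c e"
  define Z where "Z = cycle_maxima n ?x"
  obtain p where p: "\<And>v. minimal_arc n ?x (p v) v" and px: "\<And>v. ?x (p v, v) = min_in n ?x v"
    using ex_minimal_arc[OF n, of ?x] by metis
  \<comment> \<open>Vertex 1 is the root, and the largest vertex of each cycle is rehung from
    it.\<close>
  define f where "f = (\<lambda>v. if v \<in> Z then 1 else p v)"
  let ?T = "parent_tree {1..n} 1 f"
  have pV: "p v \<in> {1..n} - {v}" for v using p[of v] by (auto simp: minimal_arc_def)
  have arc: "(p v, v) \<in> parcs (complete_dg n)" if "v \<in> {1..n}" for v
    using pV[of v] that by (auto simp: complete_dg_def)
  have reach: "\<exists>k. (f ^^ k) v = 1" if "v \<in> {1..n}" for v
    unfolding f_def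
  proof (rule reaches_root[where V = "{1..n}"])
    fix y ys assume y: "y \<in> {1..n}" "distinct ys" "set ys \<subseteq> {z \<in> {1..n}. z < y}"
      "\<And>i. i < Suc (length ys) \<Longrightarrow> p ((y # ys) ! i) = (ys @ [y]) ! i"
    thus "y \<in> Z"
      unfolding Z_def cycle_maxima_def minimal_cycle_def by (auto intro!: exI[of _ ys] simp: p simp flip: y(4)) 
  qed (use that n pV in auto)
  have "spanning_arborescence ?T (complete_dg n)"
  proof (rule spanning_arborescence_parent_tree)
    fix v assume "v \<in> {1..n}" "v \<noteq> 1"
    thus "f v \<noteq> v" using pV[of v] by (auto simp: f_def)
  qed (use n pV reach in \<open>auto simp: f_def\<close>)
  \<comment> \<open>Each rehung vertex adds at most 1, as \<open>h\<close> takes values in the unit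
    interval. The bound serves both the cost and the weight.\<close>
  moreover have *: "(\<Sum>e\<in>parcs ?T. h e) \<le> (\<Sum>v\<in>{1..n}. h (p v, v)) + z"
    if h: "\<And>e. e \<in> parcs (complete_dg n) \<Longrightarrow> h e \<in> {0..1}" for h :: "nat \<times> nat \<Rightarrow> real"
  proof -
    have "(\<Sum>e\<in>parcs ?T. h e) = (\<Sum>v\<in>{1..n} - {1}. h (f v, v))"
      by (rule sum_parent_tree)
    also have "\<dots> \<le> (\<Sum>v\<in>{1..n} - {1}. h (p v, v) + of_bool (v \<in> Z))"
    proof (rule sum_mono)
      fix v assume v: "v \<in> {1..n} - {1}"
      have "(1, v) \<in> parcs (complete_dg n)" using v by (auto simp: complete_dg_def)
      thus "h (f v, v) \<le> h (p v, v) + of_bool (v \<in> Z)"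
        using h[of "(p v, v)"] h[of "(1, v)"] arc[of v] v by (auto simp: f_def)
    qed
    also have "\<dots> \<le> (\<Sum>v\<in>{1..n}. h (p v, v) + of_bool (v \<in> Z))"
      using h arc by (intro sum_mono2) (auto simp: add_nonneg_nonneg)
    also have "\<dots> = (\<Sum>v\<in>{1..n}. h (p v, v)) + (\<Sum>v\<in>{1..n}. of_bool (v \<in> Z))"
      by (rule sum.distrib)
    also have "(\<Sum>v\<in>{1..n}. of_bool (v \<in> Z)) = z"
    proof -
      have "{1..n} \<inter> Z = Z" by (auto simp: Z_def cycle_maxima_def)
      thus ?thesis unfolding z_def Z_def[symmetric] by (simp add: of_bool_def sum.If_cases)
    qed
    finally show ?thesis .
  qed
  moreover have sg: "\<phi> l' \<le> \<phi> l + (l' - l) * (\<Sum>v\<in>{1..n}. c (p v, v))" for l'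
  proof -
    have "\<phi> l' \<le> (\<Sum>v\<in>{1..n}. w (p v, v) + l' * c (p v, v))"
      unfolding \<phi>_def min_sum_def by (intro sum_mono min_in_le arc)
    also have "\<dots> = (\<Sum>v\<in>{1..n}. ?x (p v, v)) + (l' - l) * (\<Sum>v\<in>{1..n}. c (p v, v))"
      by (simp add: sum.distrib sum_distrib_left algebra_simps sum_subtractf)
    finally show ?thesis unfolding \<phi>_def min_sum_def px .
  qed
  moreover have "(\<Sum>v\<in>{1..n}. c (p v, v)) \<le> (\<phi> l - \<phi> l1) / (l - l1)"
    using sg[of l1] l by (simp add: pos_le_divide_eq algebra_simps)
  moreover have "(\<Sum>v\<in>{1..n}. w (p v, v)) \<le> \<phi> l - l * ((\<phi> l2 - \<phi> l) / (l2 - l))"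
  proof -
    have "(\<phi> l2 - \<phi> l) / (l2 - l) \<le> (\<Sum>v\<in>{1..n}. c (p v, v))"
      using sg[of l2] l by (simp add: pos_divide_le_eq algebra_simps)
    hence "l * ((\<phi> l2 - \<phi> l) / (l2 - l)) \<le> l * (\<Sum>v\<in>{1..n}. c (p v, v))"
      using l by (intro mult_left_mono) auto
    moreover have "\<phi> l = (\<Sum>v\<in>{1..n}. w (p v, v)) + l * (\<Sum>v\<in>{1..n}. c (p v, v))"
      unfolding \<phi>_def min_sum_def px[symmetric] by (simp add: sum.distrib sum_distrib_left)
    ultimately show ?thesis by linarith
  qed
  ultimately show ?thesis using *[OF c] *[OF w] by (intro exI[of _ ?T]) fastforce
qed

section \<open>Asymptotics of the expected minimum\<close>

text \<open>Substituting \<open>u powr (1 / a)\<close> for \<open>x\<close> gives a Beta integral.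
  It is used twice: \<open>a = s\<close>, \<open>b = 1 / s\<close> yields
  \<open>simplex_const s\<close>, and \<open>a = 2 / s\<close>, \<open>b = n - 1\<close> yields the
  mean of a minimum over \<open>n - 1\<close> arcs.\<close>

lemma has_integral_powr_Beta:
  fixes a b :: real
  assumes a: "0 < a" and b: "0 < b"
  shows "((\<lambda>x. (1 - x powr a) powr b) has_integral
           Gamma (1 / a + 1) * Gamma (b + 1) / Gamma (1 / a + b + 1)) {0..1}"
proof -
  define f where "f = (\<lambda>x::real. (1 - x powr a) powr b)"
  have cont: "continuous_on {0..1} f"
    unfolding f_def using a b
    by (intro continuous_intros continuous_on_powr') (auto simp: powr_le1)
  have "((\<lambda>x. ((1 / a) * x powr (1 / a - 1)) *\<^sub>R f (x powr (1 / a))) has_integral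
          integral {0 powr (1 / a)..1 powr (1 / a)} f) {0..1}"
  \<comment> \<open>For \<open>a > 1\<close> the substituted map is not differentiable at 0, hence
    the exceptional set \<open>{0}\<close>.\<close>
  proof (rule has_integral_substitution_strong[where s = "{0}" and c = 0 and d = 1])
    show "(\<lambda>x. x powr (1 / a)) ` {0..1} \<subseteq> {0..1::real}"
      using a by (auto simp: powr_le1)
    show "continuous_on {0..1} (\<lambda>x::real. x powr (1 / a))"
      using a by (intro continuous_on_powr') (auto intro!: continuous_intros)
    show "((\<lambda>x. x powr (1 / a)) has_field_derivative 1 / a * x powr (1 / a - 1)) (at x within {0..1})"
      if "x \<in> {0..1} - {0}" for x
      using that by (auto intro!: derivative_eq_intros)
  qed (use a cont in auto)
  hence "((\<lambda>x. (1 / a) * (x powr (1 / a - 1) * (1 - x) powr b)) has_integral integral {0..1} f) {0..1}"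
    by (subst has_integral_cong[where g = "\<lambda>x. (1 / a * x powr (1 / a - 1)) *\<^sub>R f (x powr (1 / a))"])
      (use a in \<open>auto simp: f_def powr_powr\<close>)
  moreover have "((\<lambda>x. (1 / a) * (x powr (1 / a - 1) * (1 - x) powr b)) has_integral (1 / a) * Beta (1 / a) (b + 1)) {0..1}"
    using has_integral_Beta_real[of "1 / a" "b + 1"] a b by (intro has_integral_mult_right) auto
  ultimately have "integral {0..1} f = (1 / a) * Beta (1 / a) (b + 1)"
    by (rule has_integral_unique)
  also have "\<dots> = Gamma (1 / a + 1) * Gamma (b + 1) / Gamma (1 / a + b + 1)"
  proof -
    have "1 / a \<notin> \<int>\<^sub>\<le>\<^sub>0" using a nonpos_Ints_nonpos[of "1 / a"] by force
    thus ?thesis using a Gamma_plus1[of "1 / a"] by (simp add: Beta_def add_ac)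
  qed
  finally show ?thesis
    using integrable_continuous_real[OF cont] unfolding f_def by (metis has_integral_integral)
qed

text \<open>The area of the region \<open>x powr s + y powr s \<le> 1\<close> in the positive
  quadrant.\<close>

definition simplex_const :: "real \<Rightarrow> real" where
  "simplex_const s = (Gamma (1 / s + 1))\<^sup>2 / Gamma (2 / s + 1)"

lemma simplex_const_pos: "0 < s \<Longrightarrow> 0 < simplex_const s"
  unfolding simplex_const_def
  by (intro divide_pos_pos zero_less_power Gamma_real_pos add_pos_pos) auto

lemma arb_const_eq:
  assumes "0 < s"
  shows "arb_const s = Gamma (s / 2 + 1) * simplex_const s powr (- s / 2)"
proof -
  have "Gamma (1 / s + 1) > 0"
    using assms by (intro Gamma_real_pos add_pos_pos) auto
  hence "Gamma (2 / s + 1) / (Gamma (1 / s + 1))\<^sup>2 = inverse (simplex_const s)"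
    by (simp add: simplex_const_def)
  thus ?thesis using simplex_const_pos[OF assms]
    by (simp add: arb_const_def powr_minus inverse_powr)
qed

lemma arb_const_pos: "0 < s \<Longrightarrow> 0 < arb_const s"
  using simplex_const_pos[of s] by (auto simp: arb_const_eq intro!: mult_pos_pos Gamma_real_pos)

text \<open>Euler's limit for \<open>Gamma z\<close>: the quotient is
  \<open>Gamma_series z N / Gamma z\<close>.\<close>

lemma Gamma_ratio_asymp:
  fixes z :: real
  assumes z: "0 < z"
  shows "(\<lambda>N. Gamma (real N + 1) / Gamma (real N + 1 + z) * real N powr z) \<longlonglongrightarrow> 1"
proof -
  have lim: "Gamma_series z \<longlonglongrightarrow> Gamma z"
    by (rule Gamma_series_LIMSEQ)
  have Gz: "Gamma z > 0" using z by (rule Gamma_real_pos)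
  have "(\<lambda>N. Gamma_series z N / Gamma z) \<longlonglongrightarrow> 1"
    using tendsto_divide[OF lim tendsto_const[of "Gamma z"]] Gz by simp
  moreover have "eventually (\<lambda>N. Gamma_series z N / Gamma z =
     Gamma (real N + 1) / Gamma (real N + 1 + z) * real N powr z) sequentially"
    using eventually_gt_at_top[of 0]
  proof eventually_elim
    case (elim N)
    have "pochhammer z (N + 1) = Gamma (z + real (N + 1)) / Gamma z"
      using z by (intro pochhammer_Gamma) (auto simp: nonpos_Ints_def)
    moreover have "Gamma (real N + 1) = fact N"
      by (metis Gamma_fact add.commute)
    ultimately show ?case
      using elim Gz by (simp add: Gamma_series_def powr_def add_ac mult_ac)
  qed
  ultimately show ?thesis by (rule Lim_transform_eventually)
qed

lemma has_integral_powr_Beta_scaled: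
  fixes a b :: real
  assumes a: "0 < a" and b: "0 < b" and y: "0 < y"
  shows "((\<lambda>x. (1 - (x / y) powr a) powr b) has_integral
           y * (Gamma (1 / a + 1) * Gamma (b + 1) / Gamma (1 / a + b + 1))) {0..y}"
proof -
  have "(\<lambda>x. x / (1 / y)) ` {0..1} = {0..y}"
    using y by (subst image_divide_atLeastAtMost) auto
  thus ?thesis
    using has_integral_stretch_real[OF has_integral_powr_Beta[OF a b], of "1 / y"] y by simp
qed

text \<open>The mean of one minimum in units of its scale \<open>sqrt l * n powr (- s / 2)\<close>,
  truncated at \<open>ln n\<close> units and written as the integral of its tail probability. In
  these units the multiplier cancels.\<close>

definition trunc_mean :: "real \<Rightarrow> nat \<Rightarrow> real" where
  "trunc_mean s n = integral {0..ln (real n)} (\<lambda>x. (1 - simplex_const s * x powr (2 / s) / real n) ^ (n - 1))"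

text \<open>The exponent has at least the order of \<open>ln n\<close> squared, which beats every
  power of \<open>n\<close>; for \<open>p = 1\<close> the outcome would depend on \<open>D\<close>
  and \<open>q\<close>.\<close>

lemma exp_ln_powr_tendsto:
  fixes D p q :: real
  assumes D: "0 < D" and p: "2 \<le> p"
  shows "(\<lambda>n. real n powr q * exp (- (D * ln (real n) powr p * (real (n - 1) / real n)))) \<longlonglongrightarrow> 0"
proof (rule tendsto_sandwich[where f = "\<lambda>_. 0"])
  show "(\<lambda>n. real n powr q * exp (- (D * ln (real n) ^ 2 * (real (n - 1) / real n)))) \<longlonglongrightarrow> 0"
  proof -
    have "(\<lambda>n. real n powr q * exp (- (D * ln (real n) ^ 2 * ((real n - 1) / real n)))) \<longlonglongrightarrow> 0"
      using D by real_asymp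
    thus ?thesis
      by (rule Lim_transform_eventually)
         (use eventually_gt_at_top[of 0] in \<open>eventually_elim, simp add: of_nat_diff\<close>)
  qed
  have "eventually (\<lambda>n. ln (real n) \<ge> 1) sequentially" by real_asymp
  thus "eventually (\<lambda>n. real n powr q * exp (- (D * ln (real n) powr p * (real (n - 1) / real n)))
     \<le> real n powr q * exp (- (D * ln (real n) ^ 2 * (real (n - 1) / real n)))) sequentially"
  proof eventually_elim
    case (elim n)
    have "ln (real n) ^ 2 = ln (real n) powr 2" using elim by simp
    also have "\<dots> \<le> ln (real n) powr p" using elim p by (intro powr_mono) auto
    finally have "D * ln (real n) ^ 2 * (real (n - 1) / real n) \<le> D * ln (real n) powr p * (real (n - 1) / real n)"
      using D by (intro mult_right_mono mult_left_mono) auto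
    thus ?case by (intro mult_left_mono) auto
  qed
qed auto

lemma one_minus_power_le_exp:
  fixes x :: real
  assumes "x \<le> 1"
  shows "(1 - x) ^ k \<le> exp (- (x * real k))"
proof -
  have "(1 - x) ^ k \<le> exp (- x) ^ k"
    using assms exp_ge_add_one_self[of "- x"] by (intro power_mono) auto
  thus ?thesis by (simp add: exp_of_nat_mult[symmetric] mult_ac)
qed

text \<open>Without truncation the integral is a Beta value, whose asymptotics follow from the Gamma
  quotient. The part beyond \<open>ln n\<close> is at most the length of the range times the
  integrand's bound at \<open>ln n\<close>, and this vanishes.\<close>

lemma trunc_mean_tendsto:
  assumes s: "0 < s" "s < 1"
  shows "trunc_mean s \<longlonglongrightarrow> arb_const s"
proof -
  define D where "D = simplex_const s"
  have D: "D > 0" unfolding D_def using s by (intro simplex_const_pos) auto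
  define p where "p = 2 / s"
  have p: "2 \<le> p" "p > 0" using s by (auto simp: p_def field_simps)
  \<comment> \<open>The point where the base of the integrand vanishes, that is,
    \<open>D * y n powr p = n\<close>.\<close>
  define y where "y n = (real n / D) powr (s / 2)" for n
  define f where "f n x = (1 - D * x powr p / real n) ^ (n - 1)" for n x
  define full where "full n = y n * (Gamma (s / 2 + 1) * Gamma (real (n - 1) + 1) / Gamma (s / 2 + real (n - 1) + 1))" for n
  have f_eq: "f n x = (1 - (x / y n) powr p) powr real (n - 1)" if "n \<ge> 2" "0 \<le> x" "x < y n" for n x
  proof -
    have y: "y n > 0" using that D by (simp add: y_def)
    have "y n powr p = real n / D" using s D by (simp add: y_def p_def powr_powr)
    hence eq: "D * x powr p / real n = (x / y n) powr p"
      using that y D by (simp add: powr_divide)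
    have "(x / y n) powr p < 1 powr p"
      using that p by (intro powr_less_mono2) auto
    hence "1 - (x / y n) powr p > 0" by simp
    thus ?thesis by (simp only: f_def eq powr_realpow)
  qed
  have full: "(f n has_integral full n) {0..y n}" if n: "n \<ge> 2" for n
  proof -
    have y: "y n > 0" using n D by (simp add: y_def)
    have "((\<lambda>x. (1 - (x / y n) powr p) powr real (n - 1)) has_integral full n) {0..y n}"
      using has_integral_powr_Beta_scaled[of p "real (n - 1)" "y n"] n p y by (simp add: full_def p_def)
    thus ?thesis
      by (rule has_integral_spike_finite[where S = "{y n}", rotated 2]) (use f_eq n in auto)
  qed
  have full_lim: "full \<longlonglongrightarrow> arb_const s"
  proof -
    have "(\<lambda>n. Gamma (real n + 1) / Gamma (real n + 1 + s / 2) * real n powr (s / 2)) \<longlonglongrightarrow> 1"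
      using Gamma_ratio_asymp[of "s / 2"] s by simp
    moreover have "(\<lambda>n. (real (Suc n) / real n) powr (s / 2)) \<longlonglongrightarrow> 1"
    proof -
      have "(\<lambda>n. real (Suc n) / real n) \<longlonglongrightarrow> 1" by real_asymp
      from tendsto_powr[OF this tendsto_const, of "s / 2"] show ?thesis by simp
    qed
    ultimately have "(\<lambda>n. Gamma (s / 2 + 1) * D powr (- s / 2) *
        (Gamma (real n + 1) / Gamma (real n + 1 + s / 2) * real n powr (s / 2) * (real (Suc n) / real n) powr (s / 2)))
        \<longlonglongrightarrow> Gamma (s / 2 + 1) * D powr (- s / 2) * (1 * 1)"
      by (intro tendsto_intros)
    moreover have "eventually (\<lambda>n. Gamma (s / 2 + 1) * D powr (- s / 2) *
        (Gamma (real n + 1) / Gamma (real n + 1 + s / 2) * real n powr (s / 2) * (real (Suc n) / real n) powr (s / 2))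
        = full (Suc n)) sequentially"
      using eventually_gt_at_top[of 0]
    proof eventually_elim
      case (elim n)
      have "full (Suc n) = (real (Suc n) / D) powr (s / 2) * (Gamma (s / 2 + 1) * Gamma (real n + 1) / Gamma (s / 2 + real n + 1))"
        by (simp add: full_def y_def)
      also have "(real (Suc n) / D) powr (s / 2) = (real n powr (s / 2) * (real (Suc n) / real n) powr (s / 2)) * D powr (- s / 2)"
      proof -
        define r where "r = real (Suc n) / real n"
        have "real (Suc n) / D = real n * r / D" "r \<ge> 0" using elim by (auto simp: r_def)
        thus ?thesis
          using powr_divide[of "real n * r" D "s / 2"] powr_mult[of "real n" r "s / 2"] D
          unfolding r_def[symmetric] by (simp add: powr_minus_divide)
      qed
      finally show ?case by (simp add: add_ac)
    qed
    ultimately have "(\<lambda>n. full (Suc n)) \<longlonglongrightarrow> arb_const s"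
      using s by (simp add: arb_const_eq D_def Lim_transform_eventually)
    thus ?thesis by (rule filterlim_sequentially_Suc[THEN iffD1])
  qed
  have "eventually (\<lambda>n. \<bar>trunc_mean s n - full n\<bar> \<le>
    D powr (- s / 2) * (real n powr (s / 2) * exp (- (D * ln (real n) powr p * (real (n - 1) / real n))))) sequentially"
  proof -
    have "eventually (\<lambda>n. ln (real n) \<le> real n powr (s / 2) * D powr (- s / 2)) sequentially"
    proof -
      have "0 < s / 2" "0 < D powr (- s / 2)" using s D by auto
      thus ?thesis by real_asymp
    qed
    thus ?thesis using eventually_ge_at_top[of 2]
    proof eventually_elim
      case (elim n)
      define E where "E = exp (- (D * ln (real n) powr p * (real (n - 1) / real n)))"
      have y_eq: "real n powr (s / 2) * D powr (- s / 2) = y n"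
        using powr_divide[of "real n" D "s / 2"] D by (simp add: y_def powr_minus_divide)
      with elim have ln: "0 \<le> ln (real n)" "ln (real n) \<le> y n" by auto
      have f_cont: "f n integrable_on {a..b}" if "0 \<le> a" for a b
        unfolding f_def using p elim that by (intro integrable_continuous_real continuous_intros continuous_on_powr') auto
      have ypow: "y n powr p = real n / D" using s D by (simp add: y_def p_def powr_powr)
      have bound: "D * x powr p / real n \<le> 1" if "0 \<le> x" "x \<le> y n" for x
      proof -
        have "x powr p \<le> y n powr p" using that p by (intro powr_mono2) auto
        thus ?thesis using ypow D elim by (simp add: field_simps)
      qed
      have "full n = integral {0..ln (real n)} (f n) + integral {ln (real n)..y n} (f n)"
        using Henstock_Kurzweil_Integration.integral_combine[of 0 "ln (real n)" "y n" "f n"] ln f_cont[of 0] full[of n] elim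
        by (simp add: integral_unique)
      moreover have "integral {ln (real n)..y n} (f n) \<ge> 0"
        using bound ln by (intro integral_nonneg f_cont) (auto simp: f_def)
      moreover have "integral {ln (real n)..y n} (f n) \<le> integral {ln (real n)..y n} (\<lambda>_. E)"
        unfolding E_def
      proof (intro integral_le f_cont)
        fix x assume x: "x \<in> {ln (real n)..y n}"
        have "D * ln (real n) powr p / real n * real (n - 1) \<le> D * x powr p / real n * real (n - 1)"
          using x ln D p by (intro mult_right_mono divide_right_mono mult_left_mono powr_mono2) auto
        moreover have "f n x \<le> exp (- (D * x powr p / real n * real (n - 1)))"
          unfolding f_def using x ln bound[of x] by (intro one_minus_power_le_exp) auto
        ultimately show "f n x \<le> exp (- (D * ln (real n) powr p * (real (n - 1) / real n)))"
          by (smt (verit) exp_le_cancel_iff times_divide_eq_left times_divide_eq_right)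
      qed (use ln in auto)
      moreover have "\<dots> \<le> y n * E"
        using ln by (auto simp: E_def intro!: mult_right_mono)
      moreover have "trunc_mean s n = integral {0..ln (real n)} (f n)"
        by (simp add: trunc_mean_def f_def[abs_def] D_def p_def)
      moreover have "D powr (- s / 2) * (real n powr (s / 2) * E) = y n * E"
        using y_eq by (metis mult.assoc mult.commute)
      ultimately show ?case unfolding E_def[symmetric] by linarith
    qed
  qed
  moreover have "(\<lambda>n. D powr (- s / 2) * (real n powr (s / 2) * exp (- (D * ln (real n) powr p * (real (n - 1) / real n))))) \<longlonglongrightarrow> 0"
    using tendsto_mult_right_zero[OF exp_ln_powr_tendsto[OF D p(1)]] by blast
  ultimately have "(\<lambda>n. trunc_mean s n - full n) \<longlonglongrightarrow> 0"
    by (intro Lim_null_comparison[of "\<lambda>n. trunc_mean s n - full n"]) auto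
  from tendsto_add[OF this full_lim] show ?thesis by simp
qed

section \<open>The distribution of weight plus multiplied cost\<close>

lemma sets_uniform_power [measurable_cong, simp]: "sets (uniform_power s) = sets borel"
  by (simp add: uniform_power_def)

lemma space_uniform_power [simp]: "space (uniform_power s) = UNIV"
  by (simp add: uniform_power_def)

lemma prob_space_uniform_power: "prob_space (uniform_power s)"
  unfolding uniform_power_def
  by (intro prob_space.prob_space_distr prob_space_uniform_measure) auto

lemma nn_integral_uniform_power:
  assumes [measurable]: "f \<in> borel_measurable borel"
  shows "(\<integral>\<^sup>+x. f x \<partial>uniform_power s) = (\<integral>\<^sup>+u. f (u powr s) * indicator {0..1} u \<partial>lborel)"
  unfolding uniform_power_def
  by (simp add: nn_integral_distr nn_integral_uniform_measure divide_ennreal_def)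

lemma AE_uniform_power: "0 < s \<Longrightarrow> AE x in uniform_power s. x \<in> {0..1}"
  unfolding uniform_power_def
  by (subst AE_distr_iff) (auto simp: powr_le1 intro!: AE_uniform_measureI)

lemma emeasure_uniform_power_atMost:
  assumes s: "0 < s" and y: "y \<le> 1"
  shows "emeasure (uniform_power s) {..y} = (if 0 \<le> y then ennreal (y powr (1 / s)) else 0)"
proof -
  have "emeasure (uniform_power s) {..y} = (\<integral>\<^sup>+x. indicator {..y} x \<partial>uniform_power s)"
    by simp
  also have "\<dots> = (\<integral>\<^sup>+u. indicator {..y} (u powr s) * indicator {0..1} u \<partial>lborel)"
    by (rule nn_integral_uniform_power) measurable
  also have "\<dots> = (\<integral>\<^sup>+u. indicator (if 0 \<le> y then {0..y powr (1 / s)} else {}) u \<partial>lborel)"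
  proof (intro nn_integral_cong)
    fix u :: real
    have "u powr s \<le> y \<longleftrightarrow> u \<le> y powr (1 / s)" if "0 \<le> u" "0 \<le> y"
    proof
      assume "u powr s \<le> y"
      hence "(u powr s) powr (1 / s) \<le> y powr (1 / s)" using s by (intro powr_mono2) auto
      thus "u \<le> y powr (1 / s)" using s that by (simp add: powr_powr)
    next
      assume "u \<le> y powr (1 / s)"
      hence "u powr s \<le> (y powr (1 / s)) powr s" using s that by (intro powr_mono2) auto
      thus "u powr s \<le> y" using s that by (simp add: powr_powr)
    qed
    moreover have "y powr (1 / s) \<le> 1" if "0 \<le> y" using s y that by (simp add: powr_le1)
    moreover have "0 \<le> u powr s" by simp
    ultimately show "indicator {..y} (u powr s) * indicator {0..1} u =
        (indicator (if 0 \<le> y then {0..y powr (1 / s)} else {}) u :: ennreal)"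
      by (auto simp: indicator_def simp del: powr_ge_zero)
  qed
  also have "\<dots> = (if 0 \<le> y then ennreal (y powr (1 / s)) else 0)"
    by (subst nn_integral_indicator) auto
  finally show ?thesis .
qed

text \<open>Atomlessness passes on to \<open>sum_law\<close> and finally rules out ties between
  arcs.\<close>

lemma emeasure_uniform_power_singleton:
  assumes s: "0 < s"
  shows "emeasure (uniform_power s) {y} = 0"
proof -
  have "emeasure (uniform_power s) {y} = (\<integral>\<^sup>+x. indicator {y} x \<partial>uniform_power s)"
    by simp
  also have "\<dots> = (\<integral>\<^sup>+u. indicator {y} (u powr s) * indicator {0..1} u \<partial>lborel)"
    by (rule nn_integral_uniform_power) measurable
  also have "\<dots> \<le> (\<integral>\<^sup>+u. indicator {y powr (1 / s)} u \<partial>lborel)"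
    using s by (intro nn_integral_mono) (auto simp: indicator_def powr_powr)
  also have "\<dots> = 0" by simp
  finally show ?thesis by simp
qed

definition sum_law :: "real \<Rightarrow> real \<Rightarrow> real measure" where
  "sum_law s l = distr (uniform_power s \<Otimes>\<^sub>M uniform_power s) borel (\<lambda>(w, c). w + l * c)"

lemma sets_sum_law [measurable_cong, simp]: "sets (sum_law s l) = sets borel"
  by (simp add: sum_law_def)

lemma space_sum_law [simp]: "space (sum_law s l) = UNIV"
  by (simp add: sum_law_def)

lemma measurable_sum_law:
  "(\<lambda>(w, c). w + l * c) \<in> borel_measurable (uniform_power s \<Otimes>\<^sub>M uniform_power s)"
  by measurable

lemma prob_space_sum_law: "prob_space (sum_law s l)"
proof -
  interpret U: prob_space "uniform_power s" by (rule prob_space_uniform_power)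
  interpret P: pair_prob_space "uniform_power s" "uniform_power s" ..
  show ?thesis unfolding sum_law_def by (intro P.prob_space_distr measurable_sum_law)
qed

lemma emeasure_sum_law:
  assumes A [measurable]: "A \<in> sets borel"
  shows "emeasure (sum_law s l) A = (\<integral>\<^sup>+w. emeasure (uniform_power s) {c. w + l * c \<in> A} \<partial>uniform_power s)"
proof -
  interpret U: prob_space "uniform_power s" by (rule prob_space_uniform_power)
  let ?B = "(\<lambda>(w, c). w + l * c) -` A \<inter> space (uniform_power s \<Otimes>\<^sub>M uniform_power s)"
  have "?B \<in> sets (uniform_power s \<Otimes>\<^sub>M uniform_power s)"
    by (rule measurable_sets[OF measurable_sum_law A])
  hence "emeasure (sum_law s l) A = (\<integral>\<^sup>+w. emeasure (uniform_power s) (Pair w -` ?B) \<partial>uniform_power s)"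
    unfolding sum_law_def by (subst emeasure_distr[OF measurable_sum_law A]) (rule U.emeasure_pair_measure_alt)
  also have "(\<lambda>w. Pair w -` ?B) = (\<lambda>w. {c. w + l * c \<in> A})"
    by (auto simp: space_pair_measure)
  finally show ?thesis .
qed

lemma emeasure_sum_law_singleton:
  assumes "0 < s" "0 < l"
  shows "emeasure (sum_law s l) {x} = 0"
proof -
  have "{c. w + l * c \<in> {x}} = {(x - w) / l}" for w
    using assms by (auto simp: field_simps)
  thus ?thesis
    by (subst emeasure_sum_law) (simp_all add: emeasure_uniform_power_singleton assms)
qed

text \<open>For \<open>t\<close> up to both 1 and \<open>l\<close>, neither the weight nor the cost
  reaches its maximum 1 inside the region \<open>w + l * c \<le> t\<close>. In the underlying
  uniform variables the region is therefore a rescaled copy of the one measured by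
  \<open>simplex_const\<close>, and the power law is exact.\<close>

lemma measure_sum_law_atMost:
  assumes s: "0 < s" and l: "0 < l" and t: "0 \<le> t" "t \<le> 1" "t \<le> l"
  shows "measure (sum_law s l) {..t} = simplex_const s * t powr (2 / s) / l powr (1 / s)"
\<comment> \<open>At \<open>t = 0\<close> the rescaling by \<open>t powr (1 / s)\<close> would
  divide by zero.\<close>
proof (cases "t = 0")
  case True
  have "emeasure (sum_law s l) {..t} =
      (\<integral>\<^sup>+w. emeasure (uniform_power s) {..(t - w) / l} \<partial>uniform_power s)"
  proof -
    have "{c. w + l * c \<in> {..t}} = {..(t - w) / l}" for w
      using l by (auto simp: field_simps)
    thus ?thesis by (subst emeasure_sum_law) auto
  qed
  also have "\<dots> = (\<integral>\<^sup>+w. 0 \<partial>uniform_power s)"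
  proof (rule nn_integral_cong_AE)
    show "AE w in uniform_power s. emeasure (uniform_power s) {..(t - w) / l} = 0"
      using AE_uniform_power[OF s]
    proof eventually_elim
      case (elim w)
      hence "(t - w) / l \<le> 0" using True l by (auto simp: field_simps)
      thus ?case using s by (subst emeasure_uniform_power_atMost) auto
    qed
  qed
  finally show ?thesis using True by (simp add: measure_def)
next
  case False
  hence t0: "0 < t" using t by simp
  \<comment> \<open>For the uniform variable \<open>u\<close> with \<open>w = u powr s\<close>, the
    range \<open>w \<le> t\<close> is \<open>u \<le> y\<close>.\<close>
  define y where "y = t powr (1 / s)"
  have y: "0 < y" "y \<le> 1" using t0 t s by (auto simp: y_def powr_le1)
  have ys: "y powr s = t" using s t0 by (simp add: y_def powr_powr)
  define g where "g = (\<lambda>u. (t / l) powr (1 / s) * (1 - (u / y) powr s) powr (1 / s))"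
  have "emeasure (sum_law s l) {..t} =
      (\<integral>\<^sup>+w. emeasure (uniform_power s) {..(t - w) / l} \<partial>uniform_power s)"
  proof -
    have "{c. w + l * c \<in> {..t}} = {..(t - w) / l}" for w
      using l by (auto simp: field_simps)
    thus ?thesis by (subst emeasure_sum_law) auto
  qed
  also have "\<dots> = (\<integral>\<^sup>+w. (if w \<le> t then ennreal (((t - w) / l) powr (1 / s)) else 0) \<partial>uniform_power s)"
  proof (rule nn_integral_cong_AE)
    show "AE w in uniform_power s. emeasure (uniform_power s) {..(t - w) / l} =
       (if w \<le> t then ennreal (((t - w) / l) powr (1 / s)) else 0)"
      using AE_uniform_power[OF s]
    proof eventually_elim
      case (elim w)
      hence "(t - w) / l \<le> 1" "0 \<le> (t - w) / l \<longleftrightarrow> w \<le> t" using t l by (auto simp: field_simps)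
      thus ?case using s by (subst emeasure_uniform_power_atMost) auto
    qed
  qed
  also have "\<dots> = (\<integral>\<^sup>+u. (if u powr s \<le> t then ennreal (((t - u powr s) / l) powr (1 / s)) else 0) * indicator {0..1} u \<partial>lborel)"
    by (rule nn_integral_uniform_power) measurable
  also have "\<dots> = (\<integral>\<^sup>+u. ennreal (indicator {0..y} u * g u) \<partial>lborel)"
  proof (intro nn_integral_cong)
    fix u :: real
    show "(if u powr s \<le> t then ennreal (((t - u powr s) / l) powr (1 / s)) else 0) * indicator {0..1} u =
       ennreal (indicator {0..y} u * g u)"
    proof (cases "u \<in> {0..1}")
      case u: True
      have iff: "u powr s \<le> t \<longleftrightarrow> u \<le> y"
        using u y s ys powr_mono2[of s u y] powr_less_mono2[of s y u] by force
      have "((t - u powr s) / l) powr (1 / s) = g u" if "u \<le> y"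
      proof -
        have e: "(t - u powr s) / l = t / l * (1 - (u / y) powr s)"
          using y u ys t0 by (simp add: powr_divide right_diff_distrib diff_divide_distrib)
        show ?thesis unfolding g_def e by (rule powr_mult)
      qed
      thus ?thesis using u iff y by (auto simp: indicator_def)
    next
      case False
      thus ?thesis using y by (auto simp: indicator_def)
    qed
  qed
  also have "\<dots> = ennreal ((t / l) powr (1 / s) * (y * simplex_const s))"
  proof (rule nn_integral_has_integral_lborel)
    show "(\<lambda>u. indicator {0..y} u * g u) \<in> borel_measurable borel"
      unfolding g_def by measurable
    show "0 \<le> indicator {0..y} u * g u" for u by (simp add: g_def)
    have "(g has_integral ((t / l) powr (1 / s) * (y * simplex_const s))) {0..y}"
      unfolding g_def using has_integral_powr_Beta_scaled[of s "1 / s" y] s y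
      by (intro has_integral_mult_right) (simp add: simplex_const_def power2_eq_square add_ac)
    thus "((\<lambda>u. indicator {0..y} u * g u) has_integral ((t / l) powr (1 / s) * (y * simplex_const s))) UNIV"
      by (subst (asm) has_integral_restrict_UNIV[symmetric])
         (auto elim!: has_integral_eq[rotated] simp: indicator_def)
  qed
  finally have "measure (sum_law s l) {..t} = (t / l) powr (1 / s) * (y * simplex_const s)"
    using y simplex_const_pos[OF s] by (simp add: measure_def)
  also have "\<dots> = simplex_const s * (t powr (1 / s) * t powr (1 / s)) / l powr (1 / s)"
    using t0 l by (simp add: y_def powr_divide)
  also have "t powr (1 / s) * t powr (1 / s) = t powr (2 / s)"
    by (simp flip: powr_add)
  finally show ?thesis .
qed

section \<open>The random digraph\<close>

text \<open>The layer-cake formula, by Fubini for the region below \<open>Y\<close>. The clamp makes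
  a tail formula sufficient that is known on \<open>{0..b}\<close> only.\<close>

lemma (in prob_space) expectation_clamp:
  assumes [measurable]: "Y \<in> borel_measurable M"
    and tail: "\<And>t. t \<in> {0..b} \<Longrightarrow> prob {\<omega> \<in> space M. t < Y \<omega>} = g t"
    and g: "(g has_integral I) {0..b}" and [measurable]: "g \<in> borel_measurable borel" and b: "0 \<le> b"
  shows "expectation (\<lambda>\<omega>. max 0 (min b (Y \<omega>))) = I"
proof -
  define h where "h t = indicator {0..b} t * g t" for t
  have h_nonneg: "0 \<le> h t" for t
    using tail[of t] by (auto simp: h_def indicator_def simp flip: tail)
  have I: "(h has_integral I) UNIV"
    using g by (subst (asm) has_integral_restrict_UNIV[symmetric])
      (auto elim!: has_integral_eq[rotated] simp: indicator_def h_def)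
  have "(\<integral>\<^sup>+\<omega>. ennreal (max 0 (min b (Y \<omega>))) \<partial>M) =
      (\<integral>\<^sup>+\<omega>. (\<integral>\<^sup>+t. indicator {0..b} t * indicator {x. fst x < Y (snd x)} (t, \<omega>) \<partial>lborel) \<partial>M)"
  proof (intro nn_integral_cong)
    fix \<omega>
    have "(\<integral>\<^sup>+t. indicator {0..b} t * indicator {x. fst x < Y (snd x)} (t, \<omega>) \<partial>lborel) =
        (\<integral>\<^sup>+t. indicator ({0..b} \<inter> {..<Y \<omega>}) t \<partial>lborel)"
      by (intro nn_integral_cong) (auto simp: indicator_def)
    also have "\<dots> = emeasure lborel ({0..b} \<inter> {..<Y \<omega>})" by simp
    also have "\<dots> = ennreal (max 0 (min b (Y \<omega>)))"
    proof -
      consider "Y \<omega> \<le> 0" | "b < Y \<omega>" | "0 < Y \<omega>" "Y \<omega> \<le> b" by linarith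
      thus ?thesis
      proof cases
        case 1
        hence "{0..b} \<inter> {..<Y \<omega>} = {}" by auto
        thus ?thesis using 1 b by simp
      next
        case 2
        hence "{0..b} \<inter> {..<Y \<omega>} = {0..b}" by auto
        thus ?thesis using 2 b by simp
      next
        case 3
        hence "{0..b} \<inter> {..<Y \<omega>} = {0..<Y \<omega>}" by auto
        thus ?thesis using 3 b by simp
      qed
    qed
    finally show "ennreal (max 0 (min b (Y \<omega>))) =
      (\<integral>\<^sup>+t. indicator {0..b} t * indicator {x. fst x < Y (snd x)} (t, \<omega>) \<partial>lborel)" ..
  qed
  also have "\<dots> = (\<integral>\<^sup>+t. (\<integral>\<^sup>+\<omega>. indicator {0..b} t * indicator {x. fst x < Y (snd x)} (t, \<omega>) \<partial>M) \<partial>lborel)"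
  proof -
    interpret P: pair_sigma_finite lborel M
      by unfold_locales
    show ?thesis
      by (subst P.Fubini'[symmetric]) (auto simp: case_prod_beta)
  qed
  also have "\<dots> = (\<integral>\<^sup>+t. ennreal (h t) \<partial>lborel)"
  proof (intro nn_integral_cong)
    fix t
    have "(\<integral>\<^sup>+\<omega>. indicator {0..b} t * indicator {x. fst x < Y (snd x)} (t, \<omega>) \<partial>M) =
        (\<integral>\<^sup>+\<omega>. indicator {0..b} t * indicator {\<omega>\<in>space M. t < Y \<omega>} \<omega> \<partial>M)"
      by (intro nn_integral_cong) (auto simp: indicator_def)
    also have "\<dots> = indicator {0..b} t * emeasure M {\<omega>\<in>space M. t < Y \<omega>}"
      by (simp add: nn_integral_cmult)
    also have "\<dots> = ennreal (h t)"
      using tail[of t] by (auto simp: h_def indicator_def emeasure_eq_measure)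
    finally show "(\<integral>\<^sup>+\<omega>. indicator {0..b} t * indicator {x. fst x < Y (snd x)} (t, \<omega>) \<partial>M) = ennreal (h t)" .
  qed
  also have "\<dots> = ennreal I"
    by (rule nn_integral_has_integral_lborel[OF _ h_nonneg I]) (unfold h_def, measurable)
  finally have "(\<integral>\<^sup>+\<omega>. ennreal (max 0 (min b (Y \<omega>))) \<partial>M) = ennreal I" .
  moreover have "0 \<le> I" using has_integral_nonneg[OF I] h_nonneg by auto
  ultimately show ?thesis
    by (subst integral_eq_nn_integral) auto
qed

lemma (in prob_space) indep_var_of_indep_vars:
  assumes "indep_vars M' X I" "i \<in> I" "j \<in> I" "i \<noteq> j"
  shows "indep_var (M' i) (X i) (M' j) (X j)"
proof -
  have "indep_var (PiM {i} M') (\<lambda>\<omega>. restrict (\<lambda>i. X i \<omega>) {i}) (PiM {j} M') (\<lambda>\<omega>. restrict (\<lambda>i. X i \<omega>) {j})"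
    using assms by (intro indep_var_restrict[where I = I]) auto
  from indep_var_compose[OF this, of "\<lambda>f. f i" "M' i" "\<lambda>f. f j" "M' j"]
  show ?thesis by (simp add: comp_def)
qed

locale random_digraph = prob_space M for M :: "'a measure" +
  fixes n :: nat and s :: real and W C :: "nat \<times> nat \<Rightarrow> 'a \<Rightarrow> real"
  assumes n: "2 \<le> n" and s: "0 < s" "s < 1"
    and indep: "indep_vars (\<lambda>_. borel) (case_sum W C) (parcs (complete_dg n) <+> parcs (complete_dg n))"
    and W_law: "\<And>e. e \<in> parcs (complete_dg n) \<Longrightarrow> distr M borel (W e) = uniform_power s"
    and C_law: "\<And>e. e \<in> parcs (complete_dg n) \<Longrightarrow> distr M borel (C e) = uniform_power s"
begin

abbreviation E where "E \<equiv> parcs (complete_dg n)"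

definition X :: "real \<Rightarrow> 'a \<Rightarrow> nat \<times> nat \<Rightarrow> real" where
  "X l \<omega> e = W e \<omega> + l * C e \<omega>"

definition into :: "nat \<Rightarrow> (nat \<times> nat) set" where
  "into v = (\<lambda>u. (u, v)) ` ({1..n} - {v})"

lemma in_E: "(u, v) \<in> E \<longleftrightarrow> u \<in> {1..n} \<and> v \<in> {1..n} \<and> u \<noteq> v"
  by (auto simp: complete_dg_def)

lemma into_subset: "v \<in> {1..n} \<Longrightarrow> into v \<subseteq> E"
  by (auto simp: into_def in_E)

lemma finite_into: "finite (into v)"
  by (simp add: into_def)

lemma card_into: "v \<in> {1..n} \<Longrightarrow> card (into v) = n - 1"
  by (simp add: into_def card_image inj_on_def)

lemma into_nonempty: "into v \<noteq> {}"
  using in_nbrs_nonempty[OF n, of v] by (auto simp: into_def)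

lemma disjoint_into: "disjoint_family_on into A"
  by (auto simp: disjoint_family_on_def into_def)

lemma W_rv [measurable]: "e \<in> E \<Longrightarrow> random_variable borel (W e)"
  using indep unfolding indep_vars_def by (force dest: bspec[of _ _ "Inl e"])

lemma C_rv [measurable]: "e \<in> E \<Longrightarrow> random_variable borel (C e)"
  using indep unfolding indep_vars_def by (force dest: bspec[of _ _ "Inr e"])

lemma X_rv [measurable]: "e \<in> E \<Longrightarrow> random_variable borel (\<lambda>\<omega>. X l \<omega> e)"
  unfolding X_def by measurable

lemma AE_unit: "AE \<omega> in M. \<forall>e\<in>E. W e \<omega> \<in> {0..1} \<and> C e \<omega> \<in> {0..1}"
proof -
  have "AE \<omega> in M. W e \<omega> \<in> {0..1}" if "e \<in> E" for e
    using AE_uniform_power[OF s(1)] AE_distr_iff[OF W_rv[OF that], of "\<lambda>x. x \<in> {0..1}"]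
    unfolding W_law[OF that] by simp
  moreover have "AE \<omega> in M. C e \<omega> \<in> {0..1}" if "e \<in> E" for e
    using AE_uniform_power[OF s(1)] AE_distr_iff[OF C_rv[OF that], of "\<lambda>x. x \<in> {0..1}"]
    unfolding C_law[OF that] by simp
  ultimately show ?thesis
    by (intro AE_finite_allI finite_parcs_complete_dg AE_conjI) auto
qed

lemma X_law:
  assumes e: "e \<in> E"
  shows "distr M borel (\<lambda>\<omega>. X l \<omega> e) = sum_law s l"
proof -
  have "indep_var borel (case_sum W C (Inl e)) borel (case_sum W C (Inr e))"
    by (rule indep_var_of_indep_vars[OF indep]) (use e in auto)
  hence "indep_var borel (W e) borel (C e)" by simp
  hence "distr M (borel \<Otimes>\<^sub>M borel) (\<lambda>x. (W e x, C e x)) = uniform_power s \<Otimes>\<^sub>M uniform_power s"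
    unfolding indep_var_distribution_eq using W_law[OF e] C_law[OF e] by simp
  hence "sum_law s l = distr (distr M (borel \<Otimes>\<^sub>M borel) (\<lambda>x. (W e x, C e x))) borel (\<lambda>(w, c). w + l * c)"
    by (simp add: sum_law_def)
  also have "\<dots> = distr M borel (\<lambda>\<omega>. X l \<omega> e)"
    using e by (subst distr_distr) (auto simp: X_def comp_def)
  finally show ?thesis ..
qed

lemma X_indep: "indep_vars (\<lambda>_. borel) (\<lambda>e \<omega>. X l \<omega> e) E"
proof -
  have "indep_vars (\<lambda>e. PiM {Inl e, Inr e} (\<lambda>_. borel)) (\<lambda>e \<omega>. \<lambda>i\<in>{Inl e, Inr e}. case_sum W C i \<omega>) E"
    by (rule indep_vars_restrict[OF indep]) (auto simp: disjoint_family_on_def)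
  from indep_vars_compose2[OF this, of "\<lambda>e f. f (Inl e) + l * f (Inr e)" "\<lambda>_. borel"]
  show ?thesis by (simp add: X_def)
qed

lemma into_indep:
  "indep_vars (\<lambda>v. PiM (into v) (\<lambda>_. borel)) (\<lambda>v \<omega>. \<lambda>e\<in>into v. X l \<omega> e) {1..n}"
  by (rule indep_vars_restrict[OF X_indep]) (use into_subset disjoint_into in auto)

lemma prob_X_le:
  assumes e: "e \<in> E" and l: "0 < l" and t: "0 \<le> t" "t \<le> 1" "t \<le> l"
  shows "prob {\<omega> \<in> space M. X l \<omega> e \<le> t} = simplex_const s * t powr (2 / s) / l powr (1 / s)"
proof -
  have "prob {\<omega> \<in> space M. X l \<omega> e \<le> t} = measure (distr M borel (\<lambda>\<omega>. X l \<omega> e)) {..t}"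
    using e by (subst measure_distr) (auto intro!: arg_cong[of _ _ prob])
  thus ?thesis using X_law[OF e] measure_sum_law_atMost[OF s(1) l t] by simp
qed

lemma min_in_eq: "min_in n x v = Min (x ` into v)"
  by (simp add: min_in_def into_def image_image)

lemma min_in_rv [measurable]:
  assumes "v \<in> {1..n}"
  shows "random_variable borel (\<lambda>\<omega>. min_in n (X l \<omega>) v)"
  unfolding min_in_eq using assms finite_into into_nonempty into_subset
  by (intro borel_measurable_Min) (auto intro!: X_rv)

lemma min_sum_rv: "(\<lambda>\<omega>. min_sum n (X l \<omega>)) \<in> borel_measurable M"
  unfolding min_sum_def by (intro borel_measurable_sum min_in_rv)

lemma prob_min_in_gt:
  assumes v: "v \<in> {1..n}" and l: "0 < l" and t: "0 \<le> t" "t \<le> 1" "t \<le> l"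
  shows "prob {\<omega> \<in> space M. t < min_in n (X l \<omega>) v} =
    (1 - simplex_const s * t powr (2 / s) / l powr (1 / s)) ^ (n - 1)"
proof -
  have "{\<omega> \<in> space M. t < min_in n (X l \<omega>) v} = (\<Inter>e\<in>into v. (\<lambda>\<omega>. X l \<omega> e) -` {t<..} \<inter> space M)"
    using into_nonempty finite_into by (auto simp: min_in_eq)
  also have "prob \<dots> = (\<Prod>e\<in>into v. prob ((\<lambda>\<omega>. X l \<omega> e) -` {t<..} \<inter> space M))"
    using into_nonempty finite_into into_subset[OF v]
    by (intro indep_varsD[OF X_indep]) auto
  also have "\<dots> = (\<Prod>e\<in>into v. 1 - simplex_const s * t powr (2 / s) / l powr (1 / s))"
  proof (intro prod.cong refl)
    fix e assume "e \<in> into v"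
    hence e: "e \<in> E" using into_subset[OF v] by auto
    have "(\<lambda>\<omega>. X l \<omega> e) -` {t<..} \<inter> space M = space M - {\<omega> \<in> space M. X l \<omega> e \<le> t}" by auto
    also have "prob \<dots> = 1 - prob {\<omega> \<in> space M. X l \<omega> e \<le> t}"
      using e by (intro prob_compl) auto
    finally show "prob ((\<lambda>\<omega>. X l \<omega> e) -` {t<..} \<inter> space M) = 1 - simplex_const s * t powr (2 / s) / l powr (1 / s)"
      using prob_X_le[OF e l t] by simp
  qed
  finally show ?thesis using card_into[OF v] by simp
qed

lemma min_in_indep: "indep_vars (\<lambda>_. borel) (\<lambda>v \<omega>. max 0 (min b (min_in n (X l \<omega>) v))) {1..n}"
proof -
  have "(\<lambda>f. max 0 (min b (Min (f ` into v)))) \<in> PiM (into v) (\<lambda>_. borel) \<rightarrow>\<^sub>M (borel :: real measure)" for v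
    using finite_into into_nonempty by measurable
  from indep_vars_compose2[OF into_indep this] show ?thesis
    by (simp add: min_in_eq image_restrict_eq cong: image_cong_simp)
qed

section \<open>Concentration of the sum of minima\<close>

lemma AE_min_in_nonneg:
  assumes l: "0 < l"
  shows "AE \<omega> in M. \<forall>v\<in>{1..n}. 0 \<le> min_in n (X l \<omega>) v"
  using AE_unit
proof eventually_elim
  case (elim \<omega>)
  have "0 \<le> X l \<omega> e" if "e \<in> E" for e
    using elim that l by (auto simp: X_def)
  thus ?case
    using finite_into into_nonempty into_subset by (auto simp: min_in_eq subset_iff)
qed

text \<open>\<open>\<mu> l\<close> is the scale of a single minimum, and \<open>small\<close> puts
  the cutoff \<open>\<mu> l * ln n\<close> inside the range of the exact power law. The first error
  term is a union bound for some minimum exceeding the cutoff; the second is Hoeffding's inequality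
  for the clamped minima, which are independent because the arcs into different vertices
  are.\<close>

lemma prob_min_sum_deviation:
  defines "\<mu> \<equiv> \<lambda>l. sqrt l * real n powr (- s / 2)"
  assumes l: "0 < l" and small: "\<mu> l * ln (real n) \<le> 1" "\<mu> l * ln (real n) \<le> l"
    and eps: "0 < \<epsilon>" "\<bar>trunc_mean s n - arb_const s\<bar> \<le> \<epsilon> / 2"
  shows "prob {\<omega> \<in> space M. \<epsilon> * (real n * \<mu> l) < \<bar>min_sum n (X l \<omega>) - arb_const s * (real n * \<mu> l)\<bar>} \<le>
    real n powr 1 * exp (- (simplex_const s * ln (real n) powr (2 / s) * (real (n - 1) / real n))) +
    2 * exp (- (\<epsilon>\<^sup>2 / 2 * real n / (ln (real n))\<^sup>2))"
proof -
  define D where "D = simplex_const s"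
  define m where "m = \<mu> l"
  define \<tau> where "\<tau> = m * ln (real n)"
  define V where "V v \<omega> = max 0 (min \<tau> (min_in n (X l \<omega>) v))" for v \<omega>
  have n0: "0 < real n" "0 < ln (real n)" using n by auto
  have m0: "0 < m" using l n0 by (simp add: m_def \<mu>_def)
  have \<tau>0: "0 < \<tau>" using m0 n0 by (simp add: \<tau>_def)
  \<comment> \<open>The scale \<open>m\<close> is chosen for this identity: it turns the tail of a
    minimum into a function of \<open>t / m\<close> that is free of \<open>l\<close>.\<close>
  have m_pow: "m powr (2 / s) = l powr (1 / s) / n"
  proof -
    have "m powr (2 / s) = (l powr (1 / 2)) powr (2 / s) * (real n powr (- s / 2)) powr (2 / s)"
      using l by (simp add: m_def \<mu>_def powr_mult powr_half_sqrt)
    also have "\<dots> = l powr (1 / s) * real n powr (-1)"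
      using s by (simp add: powr_powr)
    finally show ?thesis using n0 by (simp add: powr_minus_divide)
  qed
  have F: "D * t powr (2 / s) / l powr (1 / s) = D * (t / m) powr (2 / s) / n" if "0 \<le> t" for t
    using that m0 l n0 by (simp add: powr_divide m_pow)
  define f where "f x = (1 - D * x powr (2 / s) / n) ^ (n - 1)" for x
  have "(f has_integral trunc_mean s n) {0..ln (real n)}"
    unfolding trunc_mean_def f_def[abs_def] D_def using s n0
    by (intro integrable_integral integrable_continuous_real continuous_intros continuous_on_powr') auto
  moreover have "(\<lambda>x. x / (1 / m)) ` {0..ln (real n)} = {0..\<tau>}"
    using m0 n0 by (subst image_divide_atLeastAtMost) (auto simp: \<tau>_def mult.commute)
  ultimately have f_int: "((\<lambda>t. f (t / m)) has_integral m * trunc_mean s n) {0..\<tau>}"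
    using has_integral_stretch_real[of f "trunc_mean s n" 0 "ln (real n)" "1 / m"] m0 by simp
  have tail: "prob {\<omega> \<in> space M. t < min_in n (X l \<omega>) v} = f (t / m)" if "v \<in> {1..n}" "t \<in> {0..\<tau>}" for v t
    using prob_min_in_gt[of v l t] that l small F[of t] by (simp add: f_def D_def \<tau>_def m_def)
  have mean: "expectation (V v) = m * trunc_mean s n" if "v \<in> {1..n}" for v
    unfolding V_def
  proof (rule expectation_clamp[OF _ _ f_int])
    show "(\<lambda>t. f (t / m)) \<in> borel_measurable borel" unfolding f_def by measurable
  qed (use that tail \<tau>0 in auto)
  interpret H: Hoeffding_ineq M "{1..n}" V "\<lambda>_. 0" "\<lambda>_. \<tau>" "\<Sum>v\<in>{1..n}. expectation (V v)"
    using min_in_indep[of \<tau> l] \<tau>0 by unfold_locales (auto simp: V_def[abs_def])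
  define B where "B = {\<omega> \<in> space M. \<epsilon> / 2 * (n * m) \<le> \<bar>(\<Sum>v\<in>{1..n}. V v \<omega>) - n * m * trunc_mean s n\<bar>}"
  have B_sets: "B \<in> events" unfolding B_def by measurable
  have "prob B \<le> 2 * exp (- 2 * (\<epsilon> / 2 * (n * m))\<^sup>2 / (\<Sum>v\<in>{1..n}. (\<tau> - 0)\<^sup>2))"
  proof -
    have "(\<Sum>v\<in>{1..n}. (\<tau> - 0)\<^sup>2) > 0" using \<tau>0 n0 by simp
    hence "prob {\<omega> \<in> space M. \<epsilon> / 2 * (n * m) \<le> \<bar>(\<Sum>v\<in>{1..n}. V v \<omega>) - (\<Sum>v\<in>{1..n}. expectation (V v))\<bar>}
       \<le> 2 * exp (- 2 * (\<epsilon> / 2 * (n * m))\<^sup>2 / (\<Sum>v\<in>{1..n}. (\<tau> - 0)\<^sup>2))"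
      using eps m0 n0 by (intro H.Hoeffding_ineq_abs_ge) auto
    thus ?thesis unfolding B_def by (simp add: mean mult_ac)
  qed
  also have "- 2 * (\<epsilon> / 2 * (n * m))\<^sup>2 / (\<Sum>v\<in>{1..n}. (\<tau> - 0)\<^sup>2) = - (\<epsilon>\<^sup>2 / 2 * n / (ln (real n))\<^sup>2)"
    using m0 n0 by (simp add: \<tau>_def power2_eq_square field_simps)
  finally have PB: "prob B \<le> 2 * exp (- (\<epsilon>\<^sup>2 / 2 * n / (ln (real n))\<^sup>2))" .
  define G where "G = (\<Union>v\<in>{1..n}. {\<omega> \<in> space M. \<tau> < min_in n (X l \<omega>) v})"
  have G_sets: "{\<omega> \<in> space M. \<tau> < min_in n (X l \<omega>) v} \<in> events" if "v \<in> {1..n}" for v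
    using that by measurable
  have "prob G \<le> (\<Sum>v\<in>{1..n}. prob {\<omega> \<in> space M. \<tau> < min_in n (X l \<omega>) v})"
    unfolding G_def using G_sets by (intro finite_measure_subadditive_finite) auto
  also have "\<dots> = n * f (ln (real n))"
    using tail[of _ \<tau>] \<tau>0 m0 by (simp add: \<tau>_def)
  also have "f (ln (real n)) \<le> exp (- (D * ln (real n) powr (2 / s) / n * real (n - 1)))"
    unfolding f_def
  proof (rule one_minus_power_le_exp)
    \<comment> \<open>The base of the power is nonnegative since the subtracted term is the
      probability that one arc lies below the cutoff.\<close>
    obtain e where e: "e \<in> E" using in_E[of 1 2] n by auto
    have "D * ln (real n) powr (2 / s) / n = prob {\<omega> \<in> space M. X l \<omega> e \<le> \<tau>}"
      using prob_X_le[OF e l, of \<tau>] F[of \<tau>] small \<tau>0 m0 by (simp add: D_def \<tau>_def m_def)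
    thus "D * ln (real n) powr (2 / s) / n \<le> 1" by simp
  qed
  finally have PG: "prob G \<le> n * exp (- (D * ln (real n) powr (2 / s) / n * real (n - 1)))"
    using n0 by (simp add: mult_left_mono)
  have "prob {\<omega> \<in> space M. \<epsilon> * (n * m) < \<bar>min_sum n (X l \<omega>) - arb_const s * (n * m)\<bar>} \<le> prob (G \<union> B)"
  proof (rule finite_measure_mono_AE)
    show "AE \<omega> in M. \<omega> \<in> {\<omega> \<in> space M. \<epsilon> * (n * m) < \<bar>min_sum n (X l \<omega>) - arb_const s * (n * m)\<bar>} \<longrightarrow> \<omega> \<in> G \<union> B"
      using AE_min_in_nonneg[OF l]
    proof (eventually_elim, intro impI)
      fix \<omega>
      assume nn: "\<forall>v\<in>{1..n}. 0 \<le> min_in n (X l \<omega>) v"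
        and \<omega>: "\<omega> \<in> {\<omega> \<in> space M. \<epsilon> * (n * m) < \<bar>min_sum n (X l \<omega>) - arb_const s * (n * m)\<bar>}"
      show "\<omega> \<in> G \<union> B"
      proof (rule ccontr)
        \<comment> \<open>Off \<open>G\<close> the clamp changes nothing. Half of
          \<open>\<epsilon>\<close> covers the random deviation and half the distance of
          \<open>trunc_mean s n\<close> from its limit.\<close>
        assume *: "\<omega> \<notin> G \<union> B"
        hence "min_sum n (X l \<omega>) = (\<Sum>v\<in>{1..n}. V v \<omega>)"
          using nn \<omega> unfolding min_sum_def G_def
          by (intro sum.cong) (force simp: V_def)+
        moreover have "\<bar>(\<Sum>v\<in>{1..n}. V v \<omega>) - n * m * trunc_mean s n\<bar> < \<epsilon> / 2 * (n * m)"
          using * \<omega> by (auto simp: B_def)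
        moreover have "\<bar>n * m * trunc_mean s n - arb_const s * (n * m)\<bar> \<le> \<epsilon> / 2 * (n * m)"
        proof -
          have "n * m * trunc_mean s n - arb_const s * (n * m) = (trunc_mean s n - arb_const s) * (n * m)"
            by (simp add: algebra_simps)
          also have "\<bar>\<dots>\<bar> \<le> \<epsilon> / 2 * (n * m)"
            unfolding abs_mult using eps m0 n0 by (intro mult_mono) auto
          finally show ?thesis .
        qed
        moreover have "\<epsilon> * (real n * m) < \<bar>min_sum n (X l \<omega>) - arb_const s * (real n * m)\<bar>"
          using \<omega> by blast
        ultimately show False by linarith
      qed
    qed
    show "G \<union> B \<in> events" using G_sets B_sets unfolding G_def by (intro sets.Un sets.finite_UN) auto
  qed
  also have "\<dots> \<le> prob G + prob B"
    using G_sets B_sets unfolding G_def by (intro measure_Un_le sets.finite_UN) auto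
  finally show ?thesis using PG PB n0 by (simp add: D_def m_def mult_ac)
qed

section \<open>Cycles of minimal arcs\<close>

lemma minimal_arc_eq:
  "minimal_arc n x u v \<longleftrightarrow> (u, v) \<in> into v \<and> (\<forall>e\<in>into v. x (u, v) \<le> x e)"
  by (auto simp: minimal_arc_def into_def)

text \<open>Which arc into \<open>v\<close> is minimal depends on the arcs into \<open>v\<close>
  alone. Measurability is stated on their coordinate space so that \<open>into_indep\<close> applies
  to these events for different \<open>v\<close>.\<close>

lemma minimal_arc_sets:
  assumes v: "v \<in> {1..n}"
  shows "{f \<in> space (PiM (into v) (\<lambda>_. borel)). minimal_arc n f u v} \<in> sets (PiM (into v) (\<lambda>_. borel))"
proof (cases "(u, v) \<in> into v")
  case True
  have "{f \<in> space (PiM (into v) (\<lambda>_. borel)). minimal_arc n f u v} =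
    {f \<in> space (PiM (into v) (\<lambda>_. borel :: real measure)). \<forall>e\<in>into v. f (u, v) \<le> f e}"
    using True by (auto simp: minimal_arc_eq)
  also have "\<dots> \<in> sets (PiM (into v) (\<lambda>_. borel))"
    using True finite_into[of v] by (intro sets.sets_Collect_finite_All') (use into_nonempty in auto)
  finally show ?thesis .
next
  case False
  thus ?thesis by (simp add: minimal_arc_eq)
qed

lemma minimal_arc_vimage:
  "(\<lambda>\<omega>. \<lambda>e\<in>into v. X l \<omega> e) -` {f \<in> space (PiM (into v) (\<lambda>_. borel)). minimal_arc n f u v} \<inter> space M =
     {\<omega> \<in> space M. minimal_arc n (X l \<omega>) u v}"
  by (auto simp: minimal_arc_eq space_PiM)

lemma minimal_arc_event:
  assumes "v \<in> {1..n}"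
  shows "{\<omega> \<in> space M. minimal_arc n (X l \<omega>) u v} \<in> events"
proof -
  have "(\<lambda>\<omega>. \<lambda>e\<in>into v. X l \<omega> e) \<in> M \<rightarrow>\<^sub>M PiM (into v) (\<lambda>_. borel)"
    using into_indep[of l] assms unfolding indep_vars_def by auto
  from measurable_sets[OF this minimal_arc_sets[OF assms]] show ?thesis
    by (simp only: minimal_arc_vimage)
qed

text \<open>For each fixed value of one variable, the other, being independent and atomless, hits it
  with probability 0. This makes the events of different arcs being minimal at one vertex disjoint
  almost surely.\<close>

lemma X_no_ties:
  assumes l: "0 < l" and e: "e \<in> E" "e' \<in> E" "e \<noteq> e'"
  shows "AE \<omega> in M. X l \<omega> e \<noteq> X l \<omega> e'"
proof -
  interpret N: prob_space "sum_law s l" by (rule prob_space_sum_law)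
  interpret P: pair_prob_space "sum_law s l" "sum_law s l" ..
  have "indep_var borel (\<lambda>\<omega>. X l \<omega> e) borel (\<lambda>\<omega>. X l \<omega> e')"
    by (rule indep_var_of_indep_vars[OF X_indep]) (use e in auto)
  hence eq: "distr M (borel \<Otimes>\<^sub>M borel) (\<lambda>\<omega>. (X l \<omega> e, X l \<omega> e')) = sum_law s l \<Otimes>\<^sub>M sum_law s l"
    unfolding indep_var_distribution_eq using X_law e by simp
  have "AE z in sum_law s l \<Otimes>\<^sub>M sum_law s l. fst z \<noteq> snd z"
  proof (rule P.AE_pair_measure)
    show "{z \<in> space (sum_law s l \<Otimes>\<^sub>M sum_law s l). fst z \<noteq> snd z} \<in> sets (sum_law s l \<Otimes>\<^sub>M sum_law s l)"
      by measurable
    have "{x} \<in> null_sets (sum_law s l)" for x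
      using emeasure_sum_law_singleton[OF s(1) l] by (simp add: null_sets_def)
    hence "AE y in sum_law s l. x \<noteq> y" for x
      by (rule eventually_mono[OF AE_not_in]) auto
    thus "AE x in sum_law s l. AE y in sum_law s l. fst (x, y) \<noteq> snd (x, y)"
      by simp
  qed
  hence "AE z in distr M (borel \<Otimes>\<^sub>M borel) (\<lambda>\<omega>. (X l \<omega> e, X l \<omega> e')). fst z \<noteq> snd z"
    by (subst eq)
  thus ?thesis
    using e by (subst (asm) AE_distr_iff) auto
qed

text \<open>By exchangeability all \<open>n - 1\<close> arcs into \<open>v\<close> are minimal with
  the same probability, and these events are almost surely disjoint, so the probabilities sum to at
  most 1.\<close>

lemma prob_minimal_arc_le:
  assumes v: "v \<in> {1..n}" and l: "0 < l"
  shows "prob {\<omega> \<in> space M. minimal_arc n (X l \<omega>) u v} \<le> 1 / (real n - 1)"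
proof (cases "(u, v) \<in> into v")
  case False
  thus ?thesis using n by (simp add: minimal_arc_eq)
next
  case True
  let ?I = "into v"
  let ?Q = "PiM ?I (\<lambda>_. sum_law s l)"
  have rv: "(\<lambda>\<omega>. \<lambda>e\<in>?I. X l \<omega> e) \<in> M \<rightarrow>\<^sub>M PiM ?I (\<lambda>_. borel)"
    using into_indep[of l] v unfolding indep_vars_def by auto
  have sub: "\<And>e. e \<in> ?I \<Longrightarrow> e \<in> E" using into_subset[OF v] by auto
  have sets_Q: "sets ?Q = sets (PiM ?I (\<lambda>_. borel))"
    by (intro sets_PiM_cong) auto
  have "indep_vars (\<lambda>_. borel) (\<lambda>e \<omega>. X l \<omega> e) ?I"
    by (rule indep_vars_subset[OF X_indep into_subset[OF v]])
  hence "distr M (PiM ?I (\<lambda>_. borel)) (\<lambda>\<omega>. \<lambda>e\<in>?I. X l \<omega> e) = PiM ?I (\<lambda>e. distr M borel (\<lambda>\<omega>. X l \<omega> e))"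
    using sub by (subst (asm) indep_vars_iff_distr_eq_PiM') (auto simp: into_nonempty)
  also have "\<dots> = ?Q" using X_law sub by (intro PiM_cong) auto
  finally have law: "distr M (PiM ?I (\<lambda>_. borel)) (\<lambda>\<omega>. \<lambda>e\<in>?I. X l \<omega> e) = ?Q" .
  define A where "A w = {f \<in> space (PiM ?I (\<lambda>_. borel)). minimal_arc n f w v}" for w
  have A_sets: "A w \<in> sets (PiM ?I (\<lambda>_. borel))" for w
    unfolding A_def by (rule minimal_arc_sets[OF v])
  have prob_A: "prob {\<omega> \<in> space M. minimal_arc n (X l \<omega>) w v} = measure ?Q (A w)" for w
    unfolding law[symmetric] by (subst measure_distr[OF rv A_sets]) (simp only: A_def minimal_arc_vimage)
  have sym: "measure ?Q (A w) = measure ?Q (A u)" if w: "(w, v) \<in> ?I" for w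
  proof -
    \<comment> \<open>Exchanging the arcs from \<open>u\<close> and from \<open>w\<close> preserves
      the product law and carries one event to the other.\<close>
    define \<pi> where "\<pi> = Transposition.transpose (u, v) (w, v)"
    have \<pi>: "\<pi> ` ?I = ?I" unfolding \<pi>_def using True w by simp
    have \<pi>in: "\<pi> e \<in> ?I" if "e \<in> ?I" for e using \<pi> that by auto
    have "distr ?Q (PiM ?I (\<lambda>e. (\<lambda>_. sum_law s l) (\<pi> e))) (\<lambda>\<omega>. \<lambda>e\<in>?I. \<omega> (\<pi> e)) = PiM ?I (\<lambda>e. (\<lambda>_. sum_law s l) (\<pi> e))"
      using prob_space_sum_law \<pi>in
      by (intro distr_PiM_reindex) (auto simp: \<pi>_def intro: inj_on_subset[OF inj_transpose])
    hence re: "distr ?Q ?Q (\<lambda>\<omega>. \<lambda>e\<in>?I. \<omega> (\<pi> e)) = ?Q" by simp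
    have "measure ?Q (A u) = measure (distr ?Q ?Q (\<lambda>\<omega>. \<lambda>e\<in>?I. \<omega> (\<pi> e))) (A u)"
      by (simp add: re)
    also have "\<dots> = measure ?Q ((\<lambda>\<omega>. \<lambda>e\<in>?I. \<omega> (\<pi> e)) -` A u \<inter> space ?Q)"
    proof (rule measure_distr)
      show "(\<lambda>\<omega>. \<lambda>e\<in>?I. \<omega> (\<pi> e)) \<in> ?Q \<rightarrow>\<^sub>M ?Q"
        using \<pi>in by (intro measurable_restrict measurable_component_singleton) auto
      show "A u \<in> sets ?Q" using A_sets sets_Q by simp
    qed
    also have "(\<lambda>\<omega>. \<lambda>e\<in>?I. \<omega> (\<pi> e)) -` A u \<inter> space ?Q = A w"
    proof -
      have \<pi>u: "\<pi> (u, v) = (w, v)" by (simp add: \<pi>_def)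
      have "(\<forall>e\<in>?I. f (w, v) \<le> f (\<pi> e)) \<longleftrightarrow> (\<forall>e\<in>?I. f (w, v) \<le> f e)" for f :: "nat \<times> nat \<Rightarrow> real"
        using \<pi> by (metis image_iff)
      thus ?thesis
        using w True \<pi>in by (auto simp: A_def minimal_arc_eq space_PiM \<pi>u)
    qed
    finally show ?thesis ..
  qed
  have "(\<Sum>w\<in>{1..n} - {v}. prob {\<omega> \<in> space M. minimal_arc n (X l \<omega>) w v}) =
      prob (\<Union>w\<in>{1..n} - {v}. {\<omega> \<in> space M. minimal_arc n (X l \<omega>) w v})"
  proof (rule measure_UNION_AE[symmetric])
    show "pairwise (\<lambda>i j. AE x in M. x \<notin> {\<omega> \<in> space M. minimal_arc n (X l \<omega>) i v} \<or>
       x \<notin> {\<omega> \<in> space M. minimal_arc n (X l \<omega>) j v}) ({1..n} - {v})"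
    proof (rule pairwiseI)
      fix i j assume ij: "i \<in> {1..n} - {v}" "j \<in> {1..n} - {v}" "i \<noteq> j"
      have "AE \<omega> in M. X l \<omega> (i, v) \<noteq> X l \<omega> (j, v)"
        using ij v by (intro X_no_ties l) (auto simp: in_E)
      thus "AE x in M. x \<notin> {\<omega> \<in> space M. minimal_arc n (X l \<omega>) i v} \<or>
       x \<notin> {\<omega> \<in> space M. minimal_arc n (X l \<omega>) j v}"
        by eventually_elim (use ij in \<open>auto simp: minimal_arc_def intro: antisym\<close>)
    qed
  qed (use minimal_arc_event[OF v] in \<open>auto simp: fmeasurable_eq_sets\<close>)
  also have "\<dots> \<le> 1" by simp
  also have "(\<Sum>w\<in>{1..n} - {v}. prob {\<omega> \<in> space M. minimal_arc n (X l \<omega>) w v}) =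
      (\<Sum>w\<in>{1..n} - {v}. measure ?Q (A u))"
    by (intro sum.cong refl) (simp add: prob_A, intro sym, auto simp: into_def)
  finally have "(real n - 1) * measure ?Q (A u) \<le> 1"
    using v n by (simp add: of_nat_diff)
  thus ?thesis using n by (simp add: prob_A pos_le_divide_eq mult.commute)
qed

lemma cycle_event:
  assumes v: "v \<in> {1..n}" and ys: "set ys \<subseteq> {1..<v}"
  shows "{\<omega> \<in> space M. minimal_cycle n (X l \<omega>) v ys} \<in> events"
proof -
  have "(v # ys) ! i \<in> {1..n}" if "i < Suc (length ys)" for i
  proof -
    have "(v # ys) ! i \<in> set (v # ys)" using that by (intro nth_mem) auto
    thus ?thesis using v ys by auto
  qed
  hence "{\<omega> \<in> space M. \<forall>i\<in>{..<Suc (length ys)}. minimal_arc n (X l \<omega>) ((ys @ [v]) ! i) ((v # ys) ! i)} \<in> events"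
    by (intro sets.sets_Collect_finite_All' minimal_arc_event) auto
  thus ?thesis by (simp only: minimal_cycle_def Ball_def lessThan_iff)
qed

text \<open>The arcs of the cycle enter distinct vertices, so the events that they are minimal are
  independent.\<close>

lemma prob_cycle_le:
  assumes v: "v \<in> {1..n}" and l: "0 < l" and ys: "distinct ys" "set ys \<subseteq> {1..<v}"
  shows "prob {\<omega> \<in> space M. minimal_cycle n (X l \<omega>) v ys}
     \<le> (1 / (real n - 1)) ^ Suc (length ys)"
proof -
  define k where "k = Suc (length ys)"
  define J where "J = set (v # ys)"
  have dist: "distinct (v # ys)" using ys by auto
  have J: "J \<subseteq> {1..n}" "finite J" "J \<noteq> {}" using v ys by (auto simp: J_def)
  have cardJ: "card J = k" using distinct_card[OF dist] by (simp add: J_def k_def)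
  \<comment> \<open>Independence is indexed by vertices, the cycle by positions; \<open>succ\<close>
    translates, which is possible because the vertices are distinct.\<close>
  define succ where "succ x = (ys @ [v]) ! the_inv_into {..<k} ((!) (v # ys)) x" for x
  have inj: "inj_on ((!) (v # ys)) {..<k}"
    using dist by (auto simp: inj_on_def k_def nth_eq_iff_index_eq simp del: distinct.simps)
  have succ: "succ ((v # ys) ! i) = (ys @ [v]) ! i" if "i < k" for i
    using the_inv_into_f_f[OF inj, of i] that by (simp add: succ_def)
  have img: "J = (!) (v # ys) ` {..<k}"
    unfolding J_def k_def by (auto simp only: set_conv_nth length_Cons)
  define A where "A x = {f \<in> space (PiM (into x) (\<lambda>_. borel)). minimal_arc n f (succ x) x}" for x
  have "(\<forall>i<k. minimal_arc n (X l \<omega>) ((ys @ [v]) ! i) ((v # ys) ! i)) \<longleftrightarrow>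
      (\<forall>x\<in>J. minimal_arc n (X l \<omega>) (succ x) x)" for \<omega>
    unfolding img by (auto simp: succ simp del: nth_Cons_0)
  hence "{\<omega> \<in> space M. minimal_cycle n (X l \<omega>) v ys} =
      (\<Inter>x\<in>J. {\<omega> \<in> space M. minimal_arc n (X l \<omega>) (succ x) x})"
    unfolding minimal_cycle_def k_def[symmetric] using J(3) by auto
  also have "\<dots> = (\<Inter>x\<in>J. (\<lambda>\<omega>. \<lambda>e\<in>into x. X l \<omega> e) -` A x \<inter> space M)"
    unfolding A_def minimal_arc_vimage ..
  also have "prob \<dots> = (\<Prod>x\<in>J. prob ((\<lambda>\<omega>. \<lambda>e\<in>into x. X l \<omega> e) -` A x \<inter> space M))"
    using J minimal_arc_sets by (intro indep_varsD[OF into_indep]) (auto simp: A_def)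
  also have "\<dots> \<le> (\<Prod>x\<in>J. 1 / (real n - 1))"
    unfolding A_def minimal_arc_vimage using J l by (intro prod_mono conjI prob_minimal_arc_le) auto
  finally show ?thesis by (simp add: cardJ k_def)
qed

lemma cycle_maxima_event_eq:
  "{\<omega> \<in> space M. v \<in> cycle_maxima n (X l \<omega>)} =
     (if v \<in> {1..n} then \<Union>ys\<in>{ys. distinct ys \<and> set ys \<subseteq> {1..<v}}.
       {\<omega> \<in> space M. minimal_cycle n (X l \<omega>) v ys} else {})"
  by (auto simp: cycle_maxima_def)

lemma finite_distinct_lists: "finite {ys. distinct ys \<and> set ys \<subseteq> {1..<v::nat}}"
  using finite_subset_distinct[of "{1..<v}"] by (simp add: conj_commute)

lemma cycle_maxima_event: "{\<omega> \<in> space M. v \<in> cycle_maxima n (X l \<omega>)} \<in> events"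
  unfolding cycle_maxima_event_eq using finite_distinct_lists[of v]
  by (auto intro!: sets.finite_UN cycle_event)

text \<open>Union bound over the at most \<open>(v - 1) ^ j\<close> lists of length
  \<open>j\<close>. The resulting geometric series has ratio \<open>(v - 1) / (n - 1)\<close> and
  sums to at most \<open>1 / (n - v)\<close>; for \<open>v = n\<close> the ratio would be 1.\<close>

lemma prob_cycle_maxima_le:
  assumes v: "v \<in> {1..<n}" and l: "0 < l"
  shows "prob {\<omega> \<in> space M. v \<in> cycle_maxima n (X l \<omega>)} \<le> 1 / real (n - v)"
proof -
  let ?L = "{ys. distinct ys \<and> set ys \<subseteq> {1..<v}}"
  let ?P = "\<lambda>ys. {\<omega> \<in> space M. minimal_cycle n (X l \<omega>) v ys}"
  let ?B = "\<lambda>j. {ys. set ys \<subseteq> {1..<v} \<and> length ys = j}"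
  define q where "q = 1 / (real n - 1)"
  have q: "0 < q" using n by (simp add: q_def)
  define r where "r = real (v - 1) * q"
  have r: "0 \<le> r" "r < 1" using v n by (auto simp: r_def q_def of_nat_diff)
  have v': "v \<in> {1..n}" using v by auto
  have "prob {\<omega> \<in> space M. v \<in> cycle_maxima n (X l \<omega>)} = prob (\<Union>ys\<in>?L. ?P ys)"
    unfolding cycle_maxima_event_eq using v' by simp
  also have "\<dots> \<le> (\<Sum>ys\<in>?L. prob (?P ys))"
    using finite_distinct_lists v' by (intro finite_measure_subadditive_finite image_subsetI cycle_event) auto
  also have "\<dots> \<le> (\<Sum>ys\<in>?L. q ^ Suc (length ys))"
    unfolding q_def using v' l by (intro sum_mono prob_cycle_le) auto
  also have "\<dots> \<le> (\<Sum>ys\<in>(\<Union>j\<in>{..<v}. ?B j). q ^ Suc (length ys))"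
  proof (rule sum_mono2)
    show "finite (\<Union>j\<in>{..<v}. ?B j)" by (auto intro!: finite_lists_length_eq)
    show "?L \<subseteq> (\<Union>j\<in>{..<v}. ?B j)"
    proof
      fix ys assume ys: "ys \<in> ?L"
      hence "length ys = card (set ys)" by (simp add: distinct_card)
      also have "\<dots> \<le> card {1..<v}" using ys by (intro card_mono) auto
      finally show "ys \<in> (\<Union>j\<in>{..<v}. ?B j)" using ys v by auto
    qed
  qed (use q in auto)
  also have "\<dots> = (\<Sum>j<v. \<Sum>ys\<in>?B j. q ^ Suc (length ys))"
    by (rule sum.UNION_disjoint) (auto intro: finite_lists_length_eq)
  also have "\<dots> = (\<Sum>j<v. q * r ^ j)"
    by (intro sum.cong refl) (simp add: card_lists_length_eq r_def power_mult_distrib mult_ac)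
  also have "\<dots> = q * ((1 - r ^ v) / (1 - r))"
    using r by (simp add: sum_gp_strict flip: sum_distrib_left)
  also have "\<dots> \<le> q * (1 / (1 - r))"
    using q r by (intro mult_left_mono divide_right_mono) auto
  also have "\<dots> = 1 / real (n - v)"
    using v n by (simp add: r_def q_def of_nat_diff field_simps)
  finally show ?thesis .
qed

lemma card_cycle_maxima: "real (card (cycle_maxima n x)) = (\<Sum>v\<in>{1..n}. indicator (cycle_maxima n x) v)"
proof -
  have "{1..n} \<inter> cycle_maxima n x = cycle_maxima n x" by (auto simp: cycle_maxima_def)
  thus ?thesis by (simp add: sum.If_cases indicator_def of_bool_def)
qed

lemma card_cycle_maxima_rv: "(\<lambda>\<omega>. real (card (cycle_maxima n (X l \<omega>)))) \<in> borel_measurable M"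
proof -
  have "(\<lambda>\<omega>. indicator {\<omega> \<in> space M. v \<in> cycle_maxima n (X l \<omega>)} \<omega> :: real) \<in> borel_measurable M" for v
    using cycle_maxima_event by (intro borel_measurable_indicator)
  hence "(\<lambda>\<omega>. \<Sum>v\<in>{1..n}. indicator {\<omega> \<in> space M. v \<in> cycle_maxima n (X l \<omega>)} \<omega> :: real) \<in> borel_measurable M"
    by (intro borel_measurable_sum)
  thus ?thesis
    by (rule measurable_cong[THEN iffD1, rotated])
      (auto simp: card_cycle_maxima indicator_def intro!: sum.cong)
qed

text \<open>Markov's inequality. The bounds \<open>1 / (n - v)\<close> sum to a harmonic number, at
  most \<open>1 + ln n\<close>, and vertex \<open>n\<close> contributes at most 1 more.\<close>

lemma prob_card_cycle_maxima_ge: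
  assumes l: "0 < l" and a: "0 < a"
  shows "prob {\<omega> \<in> space M. a \<le> real (card (cycle_maxima n (X l \<omega>)))} \<le> (2 + ln (real n)) / a"
proof -
  define S where "S v = {\<omega> \<in> space M. v \<in> cycle_maxima n (X l \<omega>)}" for v
  have S: "S v \<in> events" for v unfolding S_def by (rule cycle_maxima_event)
  let ?u = "\<lambda>\<omega>. \<Sum>v\<in>{1..n}. indicator (S v) \<omega> :: real"
  have ind: "integrable M (indicator (S v) :: 'a \<Rightarrow> real)" for v
    using S by (rule integrable_real_indicator) (simp add: less_top[symmetric])
  hence int: "integrable M ?u"
    by (intro Bochner_Integration.integrable_sum)
  have "{\<omega> \<in> space M. a \<le> real (card (cycle_maxima n (X l \<omega>)))} = {\<omega> \<in> space M. a \<le> ?u \<omega>}"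
    by (auto simp: card_cycle_maxima S_def indicator_def)
  also have "prob \<dots> \<le> expectation ?u / a"
    by (rule integral_Markov_inequality_measure[OF int, of "{}"]) (use a in \<open>auto intro!: sum_nonneg\<close>)
  also have "expectation ?u = (\<Sum>v\<in>{1..n}. prob (S v))"
    using sets.sets_into_space[OF S] by (subst Bochner_Integration.integral_sum[OF ind]) (simp add: Int_absorb2)
  also have "\<dots> \<le> 2 + ln (real n)"
  proof -
    have "{1..n} = insert n {1..<n}" using n by auto
    hence "(\<Sum>v\<in>{1..n}. prob (S v)) = prob (S n) + (\<Sum>v\<in>{1..<n}. prob (S v))" by simp
    also have "\<dots> \<le> 1 + (\<Sum>v\<in>{1..<n}. 1 / real (n - v))"
      using prob_cycle_maxima_le[OF _ l] by (intro add_mono sum_mono) (auto simp: S_def)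
    also have "(\<Sum>v\<in>{1..<n}. 1 / real (n - v)) = harm (n - 1)"
      unfolding harm_def
      by (rule sum.reindex_bij_witness[of _ "\<lambda>v. n - v" "\<lambda>v. n - v"]) (auto simp: field_simps)
    also have "harm (n - 1) \<le> ln (real (n - 1)) + 1"
    proof -
      obtain m where m: "n - 1 = Suc m" using n by (cases "n - 1") auto
      show ?thesis using decseqD[OF decseq_harm_diff_ln, of 0 m] m by (simp add: harm_expand)
    qed
    also have "ln (real (n - 1)) \<le> ln (real n)" using n by simp
    finally show ?thesis by simp
  qed
  finally show ?thesis using a by (simp add: divide_right_mono)
qed

end

section \<open>The optimum\<close>

text \<open>The index set no longer depends on the costs, so the optimum is an infimum of measurable
  functions over a fixed finite set.\<close>

lemma opt_arb_eq:
  "opt_arb n w c b = (INF T \<in> {T. spanning_arborescence T (complete_dg n)}.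
     if (\<Sum>e\<in>parcs T. c e) \<le> b then ereal (\<Sum>e\<in>parcs T. w e) else \<infinity>)"
  unfolding opt_arb_def
proof (rule antisym)
  show "(INF T\<in>{T. spanning_arborescence T (complete_dg n) \<and> sum c (parcs T) \<le> b}. ereal (sum w (parcs T)))
    \<le> (INF T\<in>{T. spanning_arborescence T (complete_dg n)}. if sum c (parcs T) \<le> b then ereal (sum w (parcs T)) else \<infinity>)"
    by (rule INF_greatest) (auto intro: INF_lower)
qed (rule INF_greatest, rule INF_lower2, auto)

lemma finite_spanning_arborescences: "finite {T. spanning_arborescence T (complete_dg n)}"
proof (rule finite_subset)
  let ?f = "\<lambda>A. \<lparr>pverts = {1..n}, parcs = A\<rparr> :: nat pair_pre_digraph"
  show "{T. spanning_arborescence T (complete_dg n)} \<subseteq> ?f ` Pow (parcs (complete_dg n))"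
  proof
    fix T assume "T \<in> {T. spanning_arborescence T (complete_dg n)}"
    hence T: "spanning (with_proj T) (with_proj (complete_dg n))" by (simp add: spanning_arborescence_def)
    hence "pverts (complete_dg n) = pverts T" "parcs T \<subseteq> parcs (complete_dg n)"
      by (simp_all add: spanning_def subgraph_def)
    hence "T = ?f (parcs T)" "parcs T \<in> Pow (parcs (complete_dg n))"
      by (simp_all add: complete_dg_def)
    thus "T \<in> ?f ` Pow (parcs (complete_dg n))" by blast
  qed
  show "finite (?f ` Pow (parcs (complete_dg n)))"
    by (intro finite_imageI) (simp add: finite_parcs_complete_dg)
qed

lemma (in random_digraph) opt_arb_rv:
  "(\<lambda>\<omega>. opt_arb n (\<lambda>e. W e \<omega>) (\<lambda>e. C e \<omega>) b) \<in> borel_measurable M"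
  unfolding opt_arb_eq
proof (rule borel_measurable_INF)
  fix T assume "T \<in> {T. spanning_arborescence T (complete_dg n)}"
  hence sub: "parcs T \<subseteq> E" using parcs_spanning_arborescence by blast
  have [measurable]: "(\<lambda>\<omega>. \<Sum>e\<in>parcs T. C e \<omega>) \<in> borel_measurable M" "(\<lambda>\<omega>. \<Sum>e\<in>parcs T. W e \<omega>) \<in> borel_measurable M"
    using sub by (auto intro!: borel_measurable_sum)
  show "(\<lambda>\<omega>. if (\<Sum>e\<in>parcs T. C e \<omega>) \<le> b then ereal (\<Sum>e\<in>parcs T. W e \<omega>) else \<infinity>) \<in> borel_measurable M"
    by measurable
qed (rule countable_finite[OF finite_spanning_arborescences])

text \<open>The deterministic part of the argument. Since \<phi> is close to a multiple of the
  square root, the squares \<open>(1 + h)\<^sup>2\<close> and \<open>(1 + 2 * h)\<^sup>2\<close>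
  make its three values nearly linear in \<open>h\<close>. The arborescence uses the middle
  multiplier: the secant to its left bounds the cost of the minimal arcs from above; the secant to
  its right bounds that cost from below and hence their weight from above.\<close>

lemma opt_arb_bounds:
  assumes n: "2 \<le> n"
    and w: "\<And>e. e \<in> parcs (complete_dg n) \<Longrightarrow> w e \<in> {0..1}"
    and c: "\<And>e. e \<in> parcs (complete_dg n) \<Longrightarrow> c e \<in> {0..1}"
    and pos: "0 < b" "0 < l" "0 < h" and t: "t = l * b"
  defines "\<phi> \<equiv> \<lambda>l. min_sum n (\<lambda>e. w e + l * c e)"
  defines "z \<equiv> real (card (cycle_maxima n (\<lambda>e. w e + ((1 + h)\<^sup>2 * l) * c e)))"
  assumes \<phi>: "\<bar>\<phi> l - 2 * t\<bar> \<le> d * t" "\<bar>\<phi> ((1 + h)\<^sup>2 * l) - 2 * (1 + h) * t\<bar> \<le> d * t"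
      "\<bar>\<phi> ((1 + 2 * h)\<^sup>2 * l) - 2 * (1 + 2 * h) * t\<bar> \<le> d * t"
    and z: "z \<le> d * b" "z \<le> d * t" and small: "1 + l \<le> d * t"
    and cost: "(2 * h + 2 * d) / (2 * h + h\<^sup>2) + d \<le> 1"
    and weight: "2 * (1 + h) + d - (1 + h)\<^sup>2 * ((2 * h - 2 * d) / (2 * h + 3 * h\<^sup>2)) + d \<le> 1 + \<eta>"
    and \<eta>: "2 * d \<le> \<eta>"
  shows "ereal ((1 - \<eta>) * t) \<le> opt_arb n w c b \<and> opt_arb n w c b \<le> ereal ((1 + \<eta>) * t)"
proof
  have t0: "0 < t" using pos t by simp
  show "ereal ((1 - \<eta>) * t) \<le> opt_arb n w c b"
    unfolding opt_arb_def
  proof (rule INF_greatest)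
    fix T assume "T \<in> {T. spanning_arborescence T (complete_dg n) \<and> sum c (parcs T) \<le> b}"
    hence "\<phi> l - (1 + l) - l * b \<le> sum w (parcs T)"
      unfolding \<phi>_def using w c pos by (intro weight_lower_bound[OF n]) auto
    moreover have "2 * d * t \<le> \<eta> * t" using \<eta> t0 by (intro mult_right_mono) auto
    moreover have "(1 - \<eta>) * t = t - \<eta> * t" by (simp add: algebra_simps)
    ultimately have "(1 - \<eta>) * t \<le> sum w (parcs T)"
      using \<phi>(1) small t by linarith
    thus "ereal ((1 - \<eta>) * t) \<le> ereal (sum w (parcs T))" by simp
  qed
  \<comment> \<open>Working at \<open>l1\<close> instead of \<open>l\<close> buys slack in the
    budget: the left secant has slope about \<open>(1 - h / 2) * b\<close>, which leaves room for
    the errors and the replaced arcs.\<close>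
  define l1 where "l1 = (1 + h)\<^sup>2 * l"
  define l2 where "l2 = (1 + 2 * h)\<^sup>2 * l"
  have diff: "l1 - l = (2 * h + h\<^sup>2) * l" "l2 - l1 = (2 * h + 3 * h\<^sup>2) * l"
    by (simp_all add: l1_def l2_def power2_eq_square algebra_simps)
  have hh: "0 < 2 * h + h\<^sup>2" "0 < 2 * h + 3 * h\<^sup>2" using pos by (auto intro!: add_pos_pos)
  have l: "0 < l1" "l < l1" "l1 < l2"
    using diff pos mult_pos_pos[OF hh(1) pos(2)] mult_pos_pos[OF hh(2) pos(2)] by linarith+
  have "\<exists>T. spanning_arborescence T (complete_dg n) \<and>
      sum c (parcs T) \<le> (\<phi> l1 - \<phi> l) / (l1 - l) + z \<and>
      sum w (parcs T) \<le> \<phi> l1 - l1 * ((\<phi> l2 - \<phi> l1) / (l2 - l1)) + z"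
    unfolding \<phi>_def z_def l1_def[symmetric] using l by (intro ex_cheap_arborescence n w c)
  then obtain T where T: "spanning_arborescence T (complete_dg n)"
      and cT: "sum c (parcs T) \<le> (\<phi> l1 - \<phi> l) / (l1 - l) + z"
      and wT: "sum w (parcs T) \<le> \<phi> l1 - l1 * ((\<phi> l2 - \<phi> l1) / (l2 - l1)) + z"
    by blast
  have "\<phi> l1 - \<phi> l \<le> (2 * h + 2 * d) * t"
    using \<phi>(1,2) by (simp add: l1_def algebra_simps)
  hence "(\<phi> l1 - \<phi> l) / (l1 - l) \<le> (2 * h + 2 * d) * t / ((2 * h + h\<^sup>2) * l)"
    unfolding diff using hh pos by (intro divide_right_mono) auto
  also have "\<dots> = (2 * h + 2 * d) / (2 * h + h\<^sup>2) * b"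
    using pos by (simp add: t)
  finally have "sum c (parcs T) \<le> ((2 * h + 2 * d) / (2 * h + h\<^sup>2) + d) * b"
    using cT z by (simp add: algebra_simps)
  also have "\<dots> \<le> 1 * b" using cost pos by (intro mult_right_mono) auto
  finally have feasible: "sum c (parcs T) \<le> b" by simp
  have "(2 * h - 2 * d) * t \<le> \<phi> l2 - \<phi> l1"
    using \<phi>(2,3) by (simp add: l1_def l2_def algebra_simps)
  hence "(2 * h - 2 * d) * t / ((2 * h + 3 * h\<^sup>2) * l) \<le> (\<phi> l2 - \<phi> l1) / (l2 - l1)"
    unfolding diff using hh pos by (intro divide_right_mono) auto
  hence "l1 * ((2 * h - 2 * d) * t / ((2 * h + 3 * h\<^sup>2) * l)) \<le> l1 * ((\<phi> l2 - \<phi> l1) / (l2 - l1))"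
    using l by (intro mult_left_mono) auto
  moreover have "l1 * ((2 * h - 2 * d) * t / ((2 * h + 3 * h\<^sup>2) * l)) = (1 + h)\<^sup>2 * ((2 * h - 2 * d) / (2 * h + 3 * h\<^sup>2)) * t"
    using pos by (simp add: l1_def)
  moreover have "\<phi> l1 \<le> (2 * (1 + h) + d) * t"
    using \<phi>(2) by (simp add: l1_def algebra_simps)
  ultimately have "sum w (parcs T) \<le> (2 * (1 + h) + d) * t - (1 + h)\<^sup>2 * ((2 * h - 2 * d) / (2 * h + 3 * h\<^sup>2)) * t + d * t"
    using wT z by linarith
  also have "\<dots> = (2 * (1 + h) + d - (1 + h)\<^sup>2 * ((2 * h - 2 * d) / (2 * h + 3 * h\<^sup>2)) + d) * t"
    by (simp add: algebra_simps)
  also have "\<dots> \<le> (1 + \<eta>) * t" using weight t0 by (intro mult_right_mono) auto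
  finally have "ereal (sum w (parcs T)) \<le> ereal ((1 + \<eta>) * t)" by simp
  thus "opt_arb n w c b \<le> ereal ((1 + \<eta>) * t)"
    unfolding opt_arb_def by (rule INF_lower2[rotated]) (use T feasible in auto)
qed

text \<open>\<open>h ^ 3\<close> is the tolerance \<open>d\<close> for the values of \<phi>. An
  error \<open>d\<close> changes a secant slope by the order of \<open>d / h\<close>, which must be
  small against the gain \<open>h / 2\<close> in the cost condition; so \<open>d\<close> has to
  vanish faster than \<open>h\<^sup>2\<close>.\<close>

lemma ex_perturbation:
  assumes "0 < (\<eta>::real)"
  shows "\<exists>h>0. (2 * h + 2 * h ^ 3) / (2 * h + h\<^sup>2) + h ^ 3 \<le> 1 \<and>
     2 * (1 + h) + h ^ 3 - (1 + h)\<^sup>2 * ((2 * h - 2 * h ^ 3) / (2 * h + 3 * h\<^sup>2)) + h ^ 3 \<le> 1 + \<eta> \<and>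
     2 * h ^ 3 \<le> \<eta>"
proof -
  have "((\<lambda>h::real. 2 * (1 + h) + h ^ 3 - (1 + h)\<^sup>2 * ((2 * h - 2 * h ^ 3) / (2 * h + 3 * h\<^sup>2)) + h ^ 3) \<longlongrightarrow> 1) (at_right 0)"
    by real_asymp
  hence "eventually (\<lambda>h::real. 2 * (1 + h) + h ^ 3 - (1 + h)\<^sup>2 * ((2 * h - 2 * h ^ 3) / (2 * h + 3 * h\<^sup>2)) + h ^ 3 < 1 + \<eta>) (at_right 0)"
    by (rule order_tendstoD) (use assms in auto)
  moreover have "eventually (\<lambda>h::real. (2 * h + 2 * h ^ 3) / (2 * h + h\<^sup>2) + h ^ 3 \<le> 1) (at_right 0)"
    by real_asymp
  moreover have "((\<lambda>h::real. 2 * h ^ 3) \<longlongrightarrow> 0) (at_right 0)" by real_asymp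
  hence "eventually (\<lambda>h::real. 2 * h ^ 3 < \<eta>) (at_right 0)"
    by (rule order_tendstoD) (use assms in auto)
  moreover have "eventually (\<lambda>h::real. 0 < h) (at_right 0)"
    by (rule eventually_at_right_less)
  ultimately have "eventually (\<lambda>h::real. 0 < h \<and> (2 * h + 2 * h ^ 3) / (2 * h + h\<^sup>2) + h ^ 3 \<le> 1 \<and>
     2 * (1 + h) + h ^ 3 - (1 + h)\<^sup>2 * ((2 * h - 2 * h ^ 3) / (2 * h + 3 * h\<^sup>2)) + h ^ 3 \<le> 1 + \<eta> \<and>
     2 * h ^ 3 \<le> \<eta>) (at_right 0)"
    by eventually_elim auto
  thus ?thesis using eventually_happens[of _ "at_right (0::real)"] by auto
qed

text \<open>The diagonal argument: \<open>e n\<close> is the least error level that is exceeded with probability at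
  most itself.\<close>

lemma whp_approxI:
  fixes M :: "nat \<Rightarrow> 'a measure" and A :: "nat \<Rightarrow> 'a \<Rightarrow> ereal" and b :: "nat \<Rightarrow> real"
  assumes M: "\<And>n. prob_space (M n)"
    and A: "eventually (\<lambda>n. A n \<in> borel_measurable (M n)) sequentially"
    and b: "eventually (\<lambda>n. 0 < b n) sequentially"
    and lim: "\<And>\<eta>. 0 < \<eta> \<Longrightarrow> (\<lambda>n. measure (M n) {\<omega> \<in> space (M n).
        ereal ((1 - \<eta>) * b n) \<le> A n \<omega> \<and> A n \<omega> \<le> ereal ((1 + \<eta>) * b n)}) \<longlonglongrightarrow> 1"
  shows "whp_approx M A (\<lambda>n \<omega>. ereal (b n))"
proof -
  define G where "G n \<eta> = {\<omega> \<in> space (M n). ereal ((1 - \<eta>) * b n) \<le> A n \<omega> \<and> A n \<omega> \<le> ereal ((1 + \<eta>) * b n)}" for n \<eta>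
  define P where "P n \<eta> = measure (M n) (G n \<eta>)" for n \<eta>
  define e where "e n = Inf {\<eta>. 0 < \<eta> \<and> 1 - \<eta> \<le> P n \<eta>}" for n
  have bdd: "bdd_below {\<eta>. 0 < \<eta> \<and> 1 - \<eta> \<le> P n \<eta>}" for n
    by (rule bdd_belowI[of _ 0]) auto
  have ne: "{\<eta>. 0 < \<eta> \<and> 1 - \<eta> \<le> P n \<eta>} \<noteq> {}" for n
  proof -
    have "(1::real) \<in> {\<eta>. 0 < \<eta> \<and> 1 - \<eta> \<le> P n \<eta>}" by (simp add: P_def)
    thus ?thesis by blast
  qed
  have e_nonneg: "0 \<le> e n" for n
    unfolding e_def by (rule cInf_greatest[OF ne]) auto
  have e_lim: "e \<longlonglongrightarrow> 0"
  proof (rule LIMSEQ_I)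
    fix r :: real assume r: "0 < r"
    have "(\<lambda>n. P n (r / 2)) \<longlonglongrightarrow> 1" using lim[of "r / 2"] r by (simp add: P_def G_def)
    hence "eventually (\<lambda>n. P n (r / 2) > 1 - r / 2) sequentially"
      by (rule order_tendstoD) (use r in auto)
    then obtain N where N: "\<And>n. n \<ge> N \<Longrightarrow> P n (r / 2) > 1 - r / 2" by (auto simp: eventually_sequentially)
    have "norm (e n - 0) < r" if "n \<ge> N" for n
    proof -
      have "e n \<le> r / 2" unfolding e_def using N[OF that] r by (intro cInf_lower[OF _ bdd]) auto
      thus ?thesis using e_nonneg[of n] r by simp
    qed
    thus "\<exists>N. \<forall>n\<ge>N. norm (e n - 0) < r" by blast
  qed
  \<comment> \<open>Strictly above the infimum, so that some admissible level lies below
    \<open>\<eta> n\<close> even if the infimum is not attained.\<close>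
  define \<eta> where "\<eta> n = e n + 1 / (real n + 1)" for n
  have \<eta>_pos: "0 < \<eta> n" for n using e_nonneg[of n] by (simp add: \<eta>_def add_nonneg_pos)
  have \<eta>_lim: "\<eta> \<longlonglongrightarrow> 0"
  proof -
    have "(\<lambda>n. 1 / (real n + 1)) \<longlonglongrightarrow> 0" by real_asymp
    from tendsto_add[OF e_lim this] show ?thesis by (simp add: \<eta>_def[abs_def])
  qed
  \<comment> \<open>\<open>G\<close> bounds \<open>A\<close> by multiples of \<open>b\<close>,
    whereas \<open>whp_approx\<close> bounds \<open>b\<close> by multiples of \<open>A\<close>.
    Inverting the relative error leads to this value:
    \<open>1 + \<epsilon> n = 1 / (1 - \<eta> n)\<close>.\<close>
  define \<epsilon> where "\<epsilon> n = \<eta> n / (1 - \<eta> n)" for n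
  have "\<epsilon> \<longlonglongrightarrow> 0"
    unfolding \<epsilon>_def using tendsto_divide[OF \<eta>_lim tendsto_diff[OF tendsto_const[of 1] \<eta>_lim]] by simp
  moreover have "(\<lambda>n. measure (M n) {\<omega> \<in> space (M n). ereal (1 - \<epsilon> n) * A n \<omega> \<le> ereal (b n) \<and>
      ereal (b n) \<le> ereal (1 + \<epsilon> n) * A n \<omega>}) \<longlonglongrightarrow> 1"
  proof (rule tendsto_sandwich)
    show "(\<lambda>n. 1 - \<eta> n) \<longlonglongrightarrow> 1" using tendsto_diff[OF tendsto_const[of 1] \<eta>_lim] by simp
    have "eventually (\<lambda>n. \<eta> n < 1) sequentially"
      by (rule order_tendstoD[OF \<eta>_lim]) auto
    with A b show "\<forall>\<^sub>F n in sequentially. 1 - \<eta> n \<le> measure (M n) {\<omega> \<in> space (M n).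
       ereal (1 - \<epsilon> n) * A n \<omega> \<le> ereal (b n) \<and> ereal (b n) \<le> ereal (1 + \<epsilon> n) * A n \<omega>}"
    proof eventually_elim
      case (elim n)
      interpret prob_space "M n" by (rule M)
      note [measurable] = elim(1)
      have "e n < \<eta> n" by (simp add: \<eta>_def)
      then obtain x where x: "0 < x" "1 - x \<le> P n x" "x < \<eta> n"
        unfolding e_def using cInf_lessD[OF ne] by blast
      have "1 - \<eta> n \<le> P n x" using x by simp
      also have "\<dots> \<le> prob {\<omega> \<in> space (M n).
         ereal (1 - \<epsilon> n) * A n \<omega> \<le> ereal (b n) \<and> ereal (b n) \<le> ereal (1 + \<epsilon> n) * A n \<omega>}"
        unfolding P_def
      proof (rule finite_measure_mono)
        show "G n x \<subseteq> {\<omega> \<in> space (M n).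
         ereal (1 - \<epsilon> n) * A n \<omega> \<le> ereal (b n) \<and> ereal (b n) \<le> ereal (1 + \<epsilon> n) * A n \<omega>}"
        proof
          fix \<omega> assume \<omega>: "\<omega> \<in> G n x"
          then obtain a where a: "A n \<omega> = ereal a"
            by (cases "A n \<omega>") (auto simp: G_def)
          have ab: "(1 - x) * b n \<le> a" "a \<le> (1 + x) * b n"
            using \<omega> a by (auto simp: G_def)
          have le: "(1 - \<eta> n) * b n \<le> (1 - x) * b n" "(1 + x) * b n \<le> (1 + \<eta> n) * b n"
            using x elim by (intro mult_right_mono; simp)+
          have a0: "(1 - \<eta> n) * b n \<le> a" "a \<le> (1 + \<eta> n) * b n" "0 < a"
            using ab le mult_pos_pos[of "1 - \<eta> n" "b n"] elim by linarith+
          have e1: "1 + \<epsilon> n = 1 / (1 - \<eta> n)" using elim by (simp add: \<epsilon>_def field_simps)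
          have "b n \<le> (1 + \<epsilon> n) * a"
            unfolding e1 using a0 elim by (simp add: field_simps)
          moreover have "(1 - \<epsilon> n) * a \<le> b n"
          proof (cases "1 - \<epsilon> n \<le> 0")
            case True
            hence "(1 - \<epsilon> n) * a \<le> 0" using a0 by (intro mult_nonpos_nonneg) auto
            thus ?thesis using elim by linarith
          next
            case False
            hence "(1 - \<epsilon> n) * a \<le> (1 - \<epsilon> n) * ((1 + \<eta> n) * b n)"
              using a0 by (intro mult_left_mono) auto
            also have "\<dots> = (1 - \<epsilon> n) * (1 + \<eta> n) * b n" by simp
            also have "(1 - \<epsilon> n) * (1 + \<eta> n) \<le> 1"
            proof -
              have "\<eta> n \<le> \<epsilon> n" unfolding \<epsilon>_def using \<eta>_pos[of n] elim
                by (simp add: field_simps)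
              hence "(1 - \<epsilon> n) * (1 + \<eta> n) \<le> (1 - \<eta> n) * (1 + \<eta> n)"
                using \<eta>_pos[of n] by (intro mult_right_mono) auto
              also have "\<dots> = 1 - \<eta> n * \<eta> n" by (simp add: algebra_simps)
              also have "\<dots> \<le> 1" by simp
              finally show ?thesis .
            qed
            hence "(1 - \<epsilon> n) * (1 + \<eta> n) * b n \<le> 1 * b n" using elim by (intro mult_right_mono) auto
            finally show ?thesis by simp
          qed
          ultimately show "\<omega> \<in> {\<omega> \<in> space (M n).
            ereal (1 - \<epsilon> n) * A n \<omega> \<le> ereal (b n) \<and> ereal (b n) \<le> ereal (1 + \<epsilon> n) * A n \<omega>}"
            using \<omega> by (simp add: a G_def)
        qed
      qed measurable
      finally show ?case .
    qed
    show "\<forall>\<^sub>F n in sequentially. measure (M n) {\<omega> \<in> space (M n).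
       ereal (1 - \<epsilon> n) * A n \<omega> \<le> ereal (b n) \<and> ereal (b n) \<le> ereal (1 + \<epsilon> n) * A n \<omega>} \<le> 1"
      using M by (intro always_eventually allI) (rule prob_space.prob_le_1)
  qed auto
  ultimately show ?thesis unfolding whp_approx_def by blast
qed

theorem theorem2:
  fixes s :: real
    and c0 :: "nat \<Rightarrow> real"
    and M :: "nat \<Rightarrow> 'a measure"
    and W C :: "nat \<Rightarrow> nat \<times> nat \<Rightarrow> 'a \<Rightarrow> real"
  assumes "0 < s" and "s < 1"
    and "\<And>n. prob_space (M n)"
    and "\<And>n. prob_space.indep_vars (M n) (\<lambda>_. borel) (case_sum (W n) (C n))
               (parcs (complete_dg n) <+> parcs (complete_dg n))"
    and "\<And>n e. e \<in> parcs (complete_dg n) \<Longrightarrow> distr (M n) borel (W n e) = uniform_power s"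
    and "\<And>n e. e \<in> parcs (complete_dg n) \<Longrightarrow> distr (M n) borel (C n e) = uniform_power s"
    and "\<forall>\<^sub>F n in sequentially. 0 < c0 n"
    and "(\<lambda>n. real n powr (1 - s) * ln (real n)) \<lless> c0"
    and "c0 \<lless> (\<lambda>n. real n / ln (real n))"
  shows "whp_approx M
           (\<lambda>n \<omega>. opt_arb n (\<lambda>e. W n e \<omega>) (\<lambda>e. C n e \<omega>) (c0 n))
           (\<lambda>n \<omega>. ereal ((arb_const s)\<^sup>2 * real n powr (2 - s) / (4 * c0 n)))"
proof (rule whp_approxI)
  define K where "K = arb_const s"
  have K: "0 < K" unfolding K_def using assms(1) by (rule arb_const_pos)
  \<comment> \<open>The value of \<open>l\<close> that maximises
    \<open>K * n powr (1 - s / 2) * sqrt l - l * c0\<close> is \<open>l n\<close>, and the maximum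
    is \<open>t n\<close>. There \<open>l * c0\<close> equals \<open>t\<close> and the first term
    equals \<open>2 * t\<close>.\<close>
  define t where "t n = K\<^sup>2 * real n powr (2 - s) / (4 * c0 n)" for n
  define l where "l n = t n / c0 n" for n
  define \<phi> where "\<phi> \<kappa> n \<omega> = min_sum n (\<lambda>e. W n e \<omega> + \<kappa> * l n * C n e \<omega>)" for \<kappa> n \<omega>
  define z where "z \<kappa> n \<omega> = real (card (cycle_maxima n (\<lambda>e. W n e \<omega> + \<kappa> * l n * C n e \<omega>)))" for \<kappa> n \<omega>
  have rd: "random_digraph (M n) n s (W n) (C n)" if "2 \<le> n" for n
    using assms(1-6) that by (auto simp: random_digraph_def random_digraph_axioms_def)
  have ev: "eventually (\<lambda>n. 0 < c0 n \<and> 3 \<le> n) sequentially"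
    using assms(7) eventually_ge_at_top[of 3] by eventually_elim auto
  have t_pos: "0 < t n" "0 < l n" if "0 < c0 n" "3 \<le> n" for n
    using that K by (auto simp: t_def l_def)
  have lim1: "(\<lambda>n. real n powr (1 - s) * ln (real n) / c0 n) \<longlonglongrightarrow> 0"
    using assms(8) by (simp add: much_less_def)
  have lim2: "(\<lambda>n. c0 n * ln (real n) / real n) \<longlonglongrightarrow> 0"
    using assms(9) by (simp add: much_less_def)
  have sqrt_l: "sqrt (l n) = K * real n powr (1 - s / 2) / (2 * c0 n)" if "0 < c0 n" for n
  proof -
    have "(real n powr (1 - s / 2))\<^sup>2 = real n powr (2 - s)"
      by (simp add: power2_eq_square flip: powr_add)
    hence "l n = (K * real n powr (1 - s / 2) / (2 * c0 n))\<^sup>2"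
      by (simp add: l_def t_def power_divide power_mult_distrib) (simp add: power2_eq_square)
    moreover have "0 \<le> K * real n powr (1 - s / 2) / (2 * c0 n)" using K that by simp
    ultimately show ?thesis by (metis real_sqrt_abs abs_of_nonneg)
  qed
  \<comment> \<open>The lower growth bound exceeds \<open>ln n\<close> by the factor
    \<open>n powr (1 - s)\<close>, which tends to infinity because \<open>s < 1\<close>.\<close>
  have lim_c0: "(\<lambda>n. (2 + ln (real n)) / c0 n) \<longlonglongrightarrow> 0"
  proof -
    have "(\<lambda>n. (2 + ln (real n)) / (real n powr (1 - s) * ln (real n))) \<longlonglongrightarrow> 0"
      using assms(2) by real_asymp
    from tendsto_mult[OF this lim1] have "(\<lambda>n. (2 + ln (real n)) / (real n powr (1 - s) * ln (real n)) *
        (real n powr (1 - s) * ln (real n) / c0 n)) \<longlonglongrightarrow> 0" by simp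
    thus ?thesis
      by (rule Lim_transform_eventually) (use ev in \<open>eventually_elim, simp\<close>)
  qed
  \<comment> \<open>The product \<open>c0 * t\<close> is
    \<open>K\<^sup>2 * n powr (2 - s) / 4\<close>, so the upper growth bound on \<open>c0\<close>
    says about \<open>t\<close> what the lower one says about \<open>c0\<close>.\<close>
  have lim_t: "(\<lambda>n. (2 + ln (real n)) / t n) \<longlonglongrightarrow> 0"
  proof -
    have "(\<lambda>n. (2 + ln (real n)) / (real n powr (1 - s) * ln (real n))) \<longlonglongrightarrow> 0"
      using assms(2) by real_asymp
    from tendsto_mult[OF tendsto_mult[OF this lim2] tendsto_const[of "4 / K\<^sup>2"]]
    have "(\<lambda>n. (2 + ln (real n)) / (real n powr (1 - s) * ln (real n)) * (c0 n * ln (real n) / real n) * (4 / K\<^sup>2)) \<longlonglongrightarrow> 0"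
      by simp
    moreover have "eventually (\<lambda>n. (2 + ln (real n)) / (real n powr (1 - s) * ln (real n)) * (c0 n * ln (real n) / real n) * (4 / K\<^sup>2)
       = (2 + ln (real n)) / t n) sequentially"
      using ev
    proof eventually_elim
      case (elim n)
      have "real n powr (2 - s) = real n powr (1 - s) * real n"
        using elim by (simp add: powr_diff power2_eq_square)
      thus ?case using elim K by (simp add: t_def field_simps)
    qed
    ultimately show ?thesis by (rule Lim_transform_eventually)
  qed
  have conc: "(\<lambda>n. measure (M n) {\<omega> \<in> space (M n). d * t n < \<bar>\<phi> \<kappa> n \<omega> - 2 * sqrt \<kappa> * t n\<bar>}) \<longlonglongrightarrow> 0"
    if \<kappa>: "0 < \<kappa>" and d: "0 < d" for \<kappa> d
  proof -
    define \<mu> where "\<mu> n = sqrt (\<kappa> * l n) * real n powr (- s / 2)" for n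
    \<comment> \<open>The tolerance \<open>d * t\<close> expressed in the unit
      \<open>n * \<mu>\<close>.\<close>
    define \<epsilon> where "\<epsilon> = d * K / (2 * sqrt \<kappa>)"
    have \<epsilon>: "0 < \<epsilon>" using \<kappa> d K by (simp add: \<epsilon>_def)
    have \<mu>_eq: "\<mu> n = sqrt \<kappa> * K / 2 * (real n powr (1 - s) / c0 n)" if "0 < c0 n" for n
    proof -
      have "real n powr (1 - s / 2) * real n powr (- s / 2) = real n powr (1 - s)"
        by (simp flip: powr_add)
      thus ?thesis
        unfolding \<mu>_def real_sqrt_mult sqrt_l[OF that] by (simp add: field_simps)
    qed
    have n\<mu>: "real n * \<mu> n = 2 * sqrt \<kappa> * t n / K" if "0 < c0 n" "3 \<le> n" for n
    proof -
      have "real n powr (2 - s) = real n powr (1 - s) * real n"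
        using that by (simp add: powr_diff power2_eq_square)
      thus ?thesis using that K by (simp add: \<mu>_eq t_def power2_eq_square)
    qed
    \<comment> \<open>The next two facts place the cutoff \<open>\<mu> n * ln n\<close> in the range
      of the exact power law: below 1 by the lower growth bound on \<open>c0\<close>, below the
      multiplier by the upper one.\<close>
    have "(\<lambda>n. sqrt \<kappa> * K / 2 * (real n powr (1 - s) * ln (real n) / c0 n)) \<longlonglongrightarrow> sqrt \<kappa> * K / 2 * 0"
      by (intro tendsto_intros lim1)
    hence "eventually (\<lambda>n. sqrt \<kappa> * K / 2 * (real n powr (1 - s) * ln (real n) / c0 n) < 1) sequentially"
      by (rule order_tendstoD) simp
    with ev have ev1: "eventually (\<lambda>n. \<mu> n * ln (real n) \<le> 1) sequentially"
      by eventually_elim (simp add: \<mu>_eq)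
    have "eventually (\<lambda>n. c0 n * ln (real n) / real n < sqrt \<kappa> * K / 2) sequentially"
      by (rule order_tendstoD[OF lim2]) (use \<kappa> K in auto)
    with ev have ev2: "eventually (\<lambda>n. \<mu> n * ln (real n) \<le> \<kappa> * l n) sequentially"
    proof eventually_elim
      case (elim n)
      have "real n powr (- s / 2) * ln (real n) \<le> sqrt (\<kappa> * l n)"
      proof -
        have "ln (real n) \<le> sqrt \<kappa> * K * real n / (2 * c0 n)"
          using elim by (simp add: field_simps)
        hence "real n powr (- s / 2) * ln (real n) \<le> real n powr (- s / 2) * (sqrt \<kappa> * K * real n / (2 * c0 n))"
          by (intro mult_left_mono) auto
        also have "real n powr (1 - s / 2) = real n powr (- s / 2) * real n"
          using elim powr_add[of "real n" "- s / 2" 1] by simp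
        hence "real n powr (- s / 2) * (sqrt \<kappa> * K * real n / (2 * c0 n)) = sqrt (\<kappa> * l n)"
          using elim by (simp add: real_sqrt_mult sqrt_l)
        finally show ?thesis .
      qed
      hence "sqrt (\<kappa> * l n) * (real n powr (- s / 2) * ln (real n)) \<le> sqrt (\<kappa> * l n) * sqrt (\<kappa> * l n)"
        using \<kappa> t_pos[of n] elim by (intro mult_left_mono) auto
      thus ?case using \<kappa> t_pos[of n] elim by (simp add: \<mu>_def)
    qed
    have "eventually (\<lambda>n. dist (trunc_mean s n) K < \<epsilon> / 2) sequentially"
      using trunc_mean_tendsto[OF assms(1,2)] \<epsilon> unfolding K_def by (intro tendstoD) auto
    with ev ev1 ev2 have "eventually (\<lambda>n. norm (measure (M n) {\<omega> \<in> space (M n). d * t n < \<bar>\<phi> \<kappa> n \<omega> - 2 * sqrt \<kappa> * t n\<bar>})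
      \<le> real n powr 1 * exp (- (simplex_const s * ln (real n) powr (2 / s) * (real (n - 1) / real n))) +
        2 * exp (- (\<epsilon>\<^sup>2 / 2 * real n / (ln (real n))\<^sup>2))) sequentially"
    proof eventually_elim
      case (elim n)
      interpret random_digraph "M n" n s "W n" "C n" using elim by (intro rd) auto
      have eqs: "arb_const s * (real n * \<mu> n) = 2 * sqrt \<kappa> * t n" "\<epsilon> * (real n * \<mu> n) = d * t n"
        using n\<mu>[of n] elim K \<kappa> by (simp_all add: \<epsilon>_def K_def)
      have \<phi>X: "\<phi> \<kappa> n \<omega> = min_sum n (X (\<kappa> * l n) \<omega>)" for \<omega>
        unfolding X_def \<phi>_def ..
      have "prob {\<omega> \<in> space (M n). \<epsilon> * (real n * \<mu> n) < \<bar>\<phi> \<kappa> n \<omega> - arb_const s * (real n * \<mu> n)\<bar>}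
        \<le> real n powr 1 * exp (- (simplex_const s * ln (real n) powr (2 / s) * (real (n - 1) / real n))) +
          2 * exp (- (\<epsilon>\<^sup>2 / 2 * real n / (ln (real n))\<^sup>2))"
        unfolding \<mu>_def \<phi>X
      proof (rule prob_min_sum_deviation)
        show "0 < \<kappa> * l n" using \<kappa> t_pos[of n] elim by simp
        show "\<bar>trunc_mean s n - arb_const s\<bar> \<le> \<epsilon> / 2"
          using elim by (simp add: dist_real_def K_def)
      qed (use elim \<epsilon> in \<open>simp_all add: \<mu>_def\<close>)
      thus ?case unfolding eqs by simp
    qed
    moreover have "(\<lambda>n. real n powr 1 * exp (- (simplex_const s * ln (real n) powr (2 / s) * (real (n - 1) / real n))) +
        2 * exp (- (\<epsilon>\<^sup>2 / 2 * real n / (ln (real n))\<^sup>2))) \<longlonglongrightarrow> 0"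
    proof -
      have "(\<lambda>n. real n powr 1 * exp (- (simplex_const s * ln (real n) powr (2 / s) * (real (n - 1) / real n)))) \<longlonglongrightarrow> 0"
        using assms(1,2) by (intro exp_ln_powr_tendsto simplex_const_pos) (auto simp: field_simps)
      moreover have "(\<lambda>n. 2 * exp (- (e * real n / (ln (real n))\<^sup>2))) \<longlonglongrightarrow> 0" if "0 < e" for e :: real
        using that by real_asymp
      from this[of "\<epsilon>\<^sup>2 / 2"] have "(\<lambda>n. 2 * exp (- (\<epsilon>\<^sup>2 / 2 * real n / (ln (real n))\<^sup>2))) \<longlonglongrightarrow> 0"
        using \<epsilon> by simp
      ultimately show ?thesis by (rule tendsto_add_zero)
    qed
    ultimately show ?thesis by (rule Lim_null_comparison)
  qed
  \<comment> \<open>\<open>a\<close> will be \<open>c0\<close> and \<open>t\<close>, since the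
    replaced arcs have to be negligible for the cost and for the weight.\<close>
  have cyc: "(\<lambda>n. measure (M n) {\<omega> \<in> space (M n). d * a n \<le> z \<kappa> n \<omega>}) \<longlonglongrightarrow> 0"
    if \<kappa>: "0 < \<kappa>" and d: "0 < d" and a: "\<And>n. 0 < c0 n \<Longrightarrow> 3 \<le> n \<Longrightarrow> 0 < a n"
      and lim: "(\<lambda>n. (2 + ln (real n)) / a n) \<longlonglongrightarrow> 0" for \<kappa> d a
  proof (rule Lim_null_comparison)
    show "eventually (\<lambda>n. norm (measure (M n) {\<omega> \<in> space (M n). d * a n \<le> z \<kappa> n \<omega>}) \<le> (2 + ln (real n)) / a n * (1 / d)) sequentially"
      using ev
    proof eventually_elim
      case (elim n)
      interpret random_digraph "M n" n s "W n" "C n" using elim by (intro rd) auto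
      have "real (card (cycle_maxima n (X (\<kappa> * l n) \<omega>))) = z \<kappa> n \<omega>" for \<omega>
        unfolding X_def z_def ..
      thus ?case
        using prob_card_cycle_maxima_ge[of "\<kappa> * l n" "d * a n"] elim \<kappa> d a[of n] t_pos[of n]
        by (simp add: mult.commute)
    qed
    show "(\<lambda>n. (2 + ln (real n)) / a n * (1 / d)) \<longlonglongrightarrow> 0"
      using tendsto_mult[OF lim tendsto_const[of "1 / d"]] by simp
  qed
  show "prob_space (M n)" for n by (rule assms(3))
  show "\<forall>\<^sub>F n in sequentially. (\<lambda>\<omega>. opt_arb n (\<lambda>e. W n e \<omega>) (\<lambda>e. C n e \<omega>) (c0 n)) \<in> borel_measurable (M n)"
    using eventually_ge_at_top[of 2] by eventually_elim (rule random_digraph.opt_arb_rv[OF rd])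
  show "\<forall>\<^sub>F n in sequentially. 0 < (arb_const s)\<^sup>2 * real n powr (2 - s) / (4 * c0 n)"
    using ev by eventually_elim (use t_pos in \<open>simp add: t_def K_def\<close>)
  fix \<eta> :: real assume "0 < \<eta>"
  then obtain h where h: "0 < h" "(2 * h + 2 * h ^ 3) / (2 * h + h\<^sup>2) + h ^ 3 \<le> 1"
     "2 * (1 + h) + h ^ 3 - (1 + h)\<^sup>2 * ((2 * h - 2 * h ^ 3) / (2 * h + 3 * h\<^sup>2)) + h ^ 3 \<le> 1 + \<eta>" "2 * h ^ 3 \<le> \<eta>"
    using ex_perturbation by blast
  define d where "d = h ^ 3"
  have d: "0 < d" using h by (simp add: d_def)
  define \<kappa>1 where "\<kappa>1 = (1 + h)\<^sup>2"
  define \<kappa>2 where "\<kappa>2 = (1 + 2 * h)\<^sup>2"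
  have \<kappa>: "0 < \<kappa>1" "0 < \<kappa>2" "sqrt \<kappa>1 = 1 + h" "sqrt \<kappa>2 = 1 + 2 * h"
    using h by (auto simp: \<kappa>1_def \<kappa>2_def)
  define far where "far \<kappa> n = {\<omega> \<in> space (M n). d * t n < \<bar>\<phi> \<kappa> n \<omega> - 2 * sqrt \<kappa> * t n\<bar>}" for \<kappa> n
  define many where "many a n = {\<omega> \<in> space (M n). d * a n \<le> z \<kappa>1 n \<omega>}" for a n
  define good where "good n = {\<omega> \<in> space (M n). ereal ((1 - \<eta>) * t n) \<le> opt_arb n (\<lambda>e. W n e \<omega>) (\<lambda>e. C n e \<omega>) (c0 n) \<and>
      opt_arb n (\<lambda>e. W n e \<omega>) (\<lambda>e. C n e \<omega>) (c0 n) \<le> ereal ((1 + \<eta>) * t n)}" for n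
  let ?P = "\<lambda>n S. measure (M n) (S n)"
  have "(\<lambda>n. measure (M n) (good n)) \<longlonglongrightarrow> 1"
  proof (rule tendsto_sandwich)
    have "(\<lambda>n. 1 - (?P n (far 1) + ?P n (far \<kappa>1) + ?P n (far \<kappa>2) + ?P n (many c0) + ?P n (many t))) \<longlonglongrightarrow> 1 - (0 + 0 + 0 + 0 + 0)"
      unfolding far_def many_def using \<kappa> d t_pos
      by (intro tendsto_diff tendsto_add tendsto_const conc cyc lim_c0 lim_t) auto
    thus "(\<lambda>n. 1 - (?P n (far 1) + ?P n (far \<kappa>1) + ?P n (far \<kappa>2) + ?P n (many c0) + ?P n (many t))) \<longlonglongrightarrow> 1"
      by simp
    \<comment> \<open>The term of the root: \<open>t\<close> tends to infinity, and
      \<open>l = t / c0\<close> is small against \<open>t\<close> because \<open>c0\<close> tends to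
      infinity as well.\<close>
    have small: "eventually (\<lambda>n. 1 + l n \<le> d * t n) sequentially"
    proof -
      have "eventually (\<lambda>n. (2 + ln (real n)) / t n < d / 2) sequentially"
           "eventually (\<lambda>n. (2 + ln (real n)) / c0 n < d / 2) sequentially"
        using d by (intro order_tendstoD[OF lim_t] order_tendstoD[OF lim_c0]; simp)+
      thus ?thesis using ev
      proof eventually_elim
        case (elim n)
        have "0 \<le> ln (real n)" using elim by simp
        hence "2 + ln (real n) < d / 2 * t n" "2 + ln (real n) < d / 2 * c0 n"
          using elim t_pos[of n] by (auto simp: field_simps)
        hence "1 \<le> d / 2 * t n" "1 \<le> d / 2 * c0 n" using \<open>0 \<le> ln (real n)\<close> by linarith+
        moreover have "l n * 1 \<le> l n * (d / 2 * c0 n)"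
          using calculation(2) elim t_pos[of n] by (intro mult_left_mono) auto
        moreover have "l n * (d / 2 * c0 n) = d / 2 * t n" using elim by (simp add: l_def)
        ultimately show ?case by linarith
      qed
    qed
    show "eventually (\<lambda>n. 1 - (?P n (far 1) + ?P n (far \<kappa>1) + ?P n (far \<kappa>2) + ?P n (many c0) + ?P n (many t)) \<le> measure (M n) (good n)) sequentially"
      using ev small
    proof eventually_elim
      case (elim n)
      interpret random_digraph "M n" n s "W n" "C n" using elim by (intro rd) auto
      have \<phi>X: "\<phi> \<kappa> n = (\<lambda>\<omega>. min_sum n (X (\<kappa> * l n) \<omega>))" for \<kappa>
        unfolding \<phi>_def X_def ..
      have zX: "z \<kappa> n = (\<lambda>\<omega>. real (card (cycle_maxima n (X (\<kappa> * l n) \<omega>))))" for \<kappa>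
        unfolding z_def X_def ..
      have far_sets: "far \<kappa> n \<in> events" for \<kappa>
        unfolding far_def \<phi>X using min_sum_rv by measurable
      have many_sets: "many a n \<in> events" for a
        unfolding many_def zX using card_cycle_maxima_rv by measurable
      \<comment> \<open>Outside these five events, and the null set where some weight or cost leaves
        the unit interval, the deterministic bounds apply.\<close>
      define bad where "bad = far 1 n \<union> far \<kappa>1 n \<union> far \<kappa>2 n \<union> many c0 n \<union> many t n"
      have bad_sets: "bad \<in> events" using far_sets many_sets by (auto simp: bad_def)
      have "prob bad \<le> ?P n (far 1) + ?P n (far \<kappa>1) + ?P n (far \<kappa>2) + ?P n (many c0) + ?P n (many t)"
        unfolding bad_def using far_sets many_sets
        by (intro order.trans[OF measure_Un_le] add_mono order.refl sets.Un) auto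
      moreover have "1 - prob bad = prob (space (M n) - bad)"
        using bad_sets by (simp add: prob_compl)
      moreover have "prob (space (M n) - bad) \<le> prob (good n)"
      proof (rule finite_measure_mono_AE)
        note [measurable] = opt_arb_rv
        show "good n \<in> events" unfolding good_def by measurable
        show "AE \<omega> in M n. \<omega> \<in> space (M n) - bad \<longrightarrow> \<omega> \<in> good n"
          using AE_unit
        proof (eventually_elim, intro impI)
          fix \<omega> assume unit: "\<forall>e\<in>E. W n e \<omega> \<in> {0..1} \<and> C n e \<omega> \<in> {0..1}" and \<omega>: "\<omega> \<in> space (M n) - bad"
          have "ereal ((1 - \<eta>) * t n) \<le> opt_arb n (\<lambda>e. W n e \<omega>) (\<lambda>e. C n e \<omega>) (c0 n) \<and>
             opt_arb n (\<lambda>e. W n e \<omega>) (\<lambda>e. C n e \<omega>) (c0 n) \<le> ereal ((1 + \<eta>) * t n)"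
          proof (rule opt_arb_bounds[where l = "l n" and h = h and d = d])
            have f: "\<bar>\<phi> \<kappa> n \<omega> - 2 * sqrt \<kappa> * t n\<bar> \<le> d * t n" if "\<omega> \<notin> far \<kappa> n" for \<kappa>
              using that \<omega> by (auto simp: far_def)
            show "\<bar>min_sum n (\<lambda>e. W n e \<omega> + l n * C n e \<omega>) - 2 * t n\<bar> \<le> d * t n"
              using f[of 1] \<omega> by (simp add: \<phi>_def bad_def)
            show "\<bar>min_sum n (\<lambda>e. W n e \<omega> + (1 + h)\<^sup>2 * l n * C n e \<omega>) - 2 * (1 + h) * t n\<bar> \<le> d * t n"
              using f[of \<kappa>1] \<omega> by (simp add: \<phi>_def bad_def \<kappa>) (simp add: \<kappa>1_def)
            show "\<bar>min_sum n (\<lambda>e. W n e \<omega> + (1 + 2 * h)\<^sup>2 * l n * C n e \<omega>) - 2 * (1 + 2 * h) * t n\<bar> \<le> d * t n"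
              using f[of \<kappa>2] \<omega> by (simp add: \<phi>_def bad_def \<kappa>) (simp add: \<kappa>2_def)
            show "real (card (cycle_maxima n (\<lambda>e. W n e \<omega> + (1 + h)\<^sup>2 * l n * C n e \<omega>))) \<le> d * c0 n"
                 "real (card (cycle_maxima n (\<lambda>e. W n e \<omega> + (1 + h)\<^sup>2 * l n * C n e \<omega>))) \<le> d * t n"
              using \<omega> by (auto simp: bad_def many_def z_def \<kappa>1_def)
          qed (use h elim unit t_pos[of n] in \<open>auto simp: d_def l_def\<close>)
          thus "\<omega> \<in> good n" using \<omega> by (simp add: good_def)
        qed
      qed
      ultimately show ?case by linarith
    qed
    show "eventually (\<lambda>n. measure (M n) (good n) \<le> 1) sequentially"
      using assms(3) by (intro always_eventually allI) (rule prob_space.prob_le_1)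
  qed auto
  thus "(\<lambda>n. measure (M n) {\<omega> \<in> space (M n).
      ereal ((1 - \<eta>) * ((arb_const s)\<^sup>2 * real n powr (2 - s) / (4 * c0 n))) \<le> opt_arb n (\<lambda>e. W n e \<omega>) (\<lambda>e. C n e \<omega>) (c0 n) \<and>
      opt_arb n (\<lambda>e. W n e \<omega>) (\<lambda>e. C n e \<omega>) (c0 n) \<le> ereal ((1 + \<eta>) * ((arb_const s)\<^sup>2 * real n powr (2 - s) / (4 * c0 n)))}) \<longlonglongrightarrow> 1"
    unfolding good_def t_def K_def .
qed

end
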